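(* Let $\varrho\in\mathcal{Q}_{e,2}$ and $\ell\in\mathbf{W}_{e,2}$. Assume that $r\mapsto\int_{\mathbb{R}}\ell(\lambda+r)e^{-\lambda^2/2}\,d\lambda$ has a strict minimum at $r=0$, and that $\widetilde\beta_N$ is well defined with respect to $\ell$ for every $N\in\mathbb{N}$. Then $$\lim_{N\to\infty}\sqrt{I_N}\big(\widetilde\beta_N-\widehat\theta_N\big)=0,\quad\mathbb{P}\text{-a.s.}$$ Moreover, for any compact set $B\subset\mathbb{R}_+$ and any $\varepsilon>0$, $$\lim_{N\to\infty}\sup_{\theta_0\in B}\mathbb{P}\Big(\sqrt{I_N}\big|\widetilde\beta_N-\widehat\theta_N\big|>\varepsilon\Big)=0.$$
   Context: $\mathbb{R}_+:=(0,\infty)$. $(\Omega,\mathscr{F},\{\mathscr{F}_t\},\mathbb{P})$ is a stochastic basis satisfying the usual assumptions, with independent standard Brownian motions $\{w_k\}_{k\in\mathbb{N}}$. $\{\mu_k\}\subset(0,\infty)$ with $\mu_k\to\infty$ (the eigenvalues of a positive definite self-adjoint operator $A$ on a separable Hilbert space), $\{q_k\}\subset(0,\infty)$, $\sigma>0$ and $T>0$ are fixed and known. For $\theta\in\mathbb{R}_+$, $u_k^\theta$ is the $k$-th Fourier mode of the solution of $du+\theta Au\,dt=\sigma\sum_ku_kh_kq_k\,dw_k$ ($h_k$ the eigenvectors of $A$), i.e. $du_k^\theta=-\theta\mu_ku_k^\theta\,dt+\sigma q_ku_k^\theta\,dw_k$, so $u_k^\theta(t)=u_k(0)\exp\big(-(\theta\mu_k+\tfrac12\sigma^2q_k^2)t+\sigma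 q_kw_k(t)\big)$, $t\in[0,T]$, with $\mathscr{F}_0$-measurable $u_k(0)\ne0$ not depending on $\theta$. Standing assumption: the well-posedness condition of the equation holds for at least one parameter value, i.e. there exist $\bar\theta>0$, $N_0\in\mathbb{N}$, $c>0$ with $2\bar\theta-\sigma^2q_k^2/\mu_k\ge c$ for all $k\ge N_0$. $\theta_0\in\mathbb{R}_+$ is the true parameter value and the observation is $U_N=U_N^{\theta_0}=(u_1,\dots,u_N)$ on $[0,T]$, $u_k:=u_k^{\theta_0}$; in suprema over $\theta_0$ the estimators are computed from $U_N^{\theta_0}$. The Fisher information is $I_N:=\frac{T}{\sigma^2}\sum_{k=1}^N\mu_k^2q_k^{-2}$ and $\widehat\theta_N:=-\dfrac{\sum_{k=1}^N\mu_kq_k^{-2}\int_0^T\frac{du_k(t)}{u_k(t)}}{T\sum_{k=1}^N\mu_k^2q_k^{-2}}$. For a prior $\varrho$ the posterior density is $$p(\theta\,|\,U_N)=\frac{e^{-I_N(\theta-\widehat\theta_N)^2/2}\varrho(\theta)}{\int_{\mathbb{R}_+}e^{-I_N(\eta-\widehat\theta_N)^2/2}\varrho(\eta)\,d\eta},\quad\theta\in\mathbb{R}_+,$$ it being understood that the denominator is finite and positive, and $$\widetilde\beta_N:=\operatorname*{arg\,min}_{\beta\in\mathbb{R}_+}\int_{\mathbb{R}_+}\ell\big(\sqrt{I_N}(\eta-\beta)\big)\,p(\eta\,|\,U_N)\,d\eta,$$ which is well defined when this minimum is strict and attained. $\mathcal{Q}_{e,2}$ is the set of $\varrho:\mathbb{R}_+\to[0,\infty)$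 that are continuous and positive on $\mathbb{R}_+$ and whose growth as $\theta\to\infty$ is bounded by one of the functions $e^{c\theta^r}$ with $c>0$, $r\in(0,2)$. $\mathbf{W}$ is the set of Borel measurable $\ell:\mathbb{R}\to[0,\infty)$ that are symmetric, non-decreasing on $[0,\infty)$, with $\ell(0)=0$, continuous at $0$ and not identically $0$; $\mathbf{W}_{e,2}$ is the set of $\ell\in\mathbf{W}$ whose growth as $|x|\to\infty$ is bounded by one of the functions $e^{c|x|^r}$ with $c>0$, $r\in(0,2)$. *)

theory Defs
  imports "HOL-Probability.Probability" "HOL-Library.Landau_Symbols"
begin

section \<open>Stochastic basis and Brownian motions\<close>

locale stochastic_basis = prob_space M + complete_measure M
  for M :: "'a measure" and F :: "real \<Rightarrow> 'a measure" +
  assumes subalgebra: "0 \<le> t \<Longrightarrow> subalgebra M (F t)"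
    and increasing: "0 \<le> s \<Longrightarrow> s \<le> t \<Longrightarrow> sets (F s) \<subseteq> sets (F t)"
    and right_continuous: "0 \<le> t \<Longrightarrow> (\<Inter>s\<in>{t<..}. sets (F s)) \<subseteq> sets (F t)"
    and null_sets_in_F0: "null_sets M \<subseteq> sets (F 0)"

text \<open>Standard Brownian motion relative to the filtration \<open>F\<close>, with time set \<open>[0,\<infinity>)\<close>.\<close>

definition brownian_motion ::
    "'a measure \<Rightarrow> (real \<Rightarrow> 'a measure) \<Rightarrow> (real \<Rightarrow> 'a \<Rightarrow> real) \<Rightarrow> bool" where
  "brownian_motion M F W \<longleftrightarrow>
     (\<forall>t\<ge>0. W t \<in> borel_measurable (F t)) \<and>
     (AE \<omega> in M. W 0 \<omega> = 0 \<and> continuous_on {0..} (\<lambda>t. W t \<omega>)) \<and>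
     (\<forall>s t. 0 \<le> s \<and> s < t \<longrightarrow>
        distributed M lborel (\<lambda>\<omega>. W t \<omega> - W s \<omega>) (normal_density 0 (sqrt (t - s))) \<and>
        prob_space.indep_set M (sets (F s))
          (sets (vimage_algebra (space M) (\<lambda>\<omega>. W t \<omega> - W s \<omega>) borel)))"

definition independent_brownian_motions ::
    "'a measure \<Rightarrow> (real \<Rightarrow> 'a measure) \<Rightarrow> (nat \<Rightarrow> real \<Rightarrow> 'a \<Rightarrow> real) \<Rightarrow> nat set \<Rightarrow> bool" where
  "independent_brownian_motions M F w K \<longleftrightarrow>
     (\<forall>k\<in>K. brownian_motion M F (w k)) \<and>
     prob_space.indep_vars M (\<lambda>_. PiM {0..} (\<lambda>_::real. borel))
       (\<lambda>k \<omega>. restrict (\<lambda>t. w k t \<omega>) {0..}) K"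

section \<open>The stochastic integral of a continuous integrand\<close>

definition is_partition :: "real \<Rightarrow> nat \<Rightarrow> (nat \<Rightarrow> real) \<Rightarrow> bool" where
  "is_partition T m \<tau> \<longleftrightarrow> \<tau> 0 = 0 \<and> \<tau> m = T \<and> (\<forall>i<m. \<tau> i < \<tau> (Suc i))"

text \<open>\<open>is_stochastic_integral M T H X J\<close>: the random variable \<open>J\<close> is a version of the Ito integral
  of \<open>H\<close> against \<open>X\<close> over \<open>[0,T]\<close>, that is, the limit in probability, as the mesh of the partition
  tends to zero, of the Riemann sums with the integrand evaluated at the left endpoints.  For a
  continuous adapted \<open>H\<close> and a continuous semimartingale \<open>X\<close>, as here, this limit exists and is
  the Ito integral; it is unique up to almost sure equality.\<close>

definition is_stochastic_integral ::
    "'a measure \<Rightarrow> real \<Rightarrow> (real \<Rightarrow> 'a \<Rightarrow> real) \<Rightarrow> (real \<Rightarrow> 'a \<Rightarrow> real) \<Rightarrow> ('a \<Rightarrow> real) \<Rightarrow> bool" where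
  "is_stochastic_integral M T H X J \<longleftrightarrow>
     J \<in> borel_measurable M \<and>
     (\<forall>\<epsilon>>0. \<exists>\<delta>>0. \<forall>m \<tau>. is_partition T m \<tau> \<and> (\<forall>i<m. \<tau> (Suc i) - \<tau> i < \<delta>) \<longrightarrow>
        measure M {\<omega> \<in> space M.
          \<bar>(\<Sum>i<m. H (\<tau> i) \<omega> * (X (\<tau> (Suc i)) \<omega> - X (\<tau> i) \<omega>)) - J \<omega>\<bar> > \<epsilon>} < \<epsilon>)"

section \<open>The Fourier modes and the maximum likelihood estimator\<close>

text \<open>Modes are indexed by \<open>k \<ge> 1\<close>.  \<open>fourier_mode\<close> is the solution of
  \<open>du = - \<theta> \<mu>\<^sub>k u dt + \<sigma> q\<^sub>k u dw\<^sub>k\<close> with initial value \<open>u0 k\<close>.\<close>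

definition fourier_mode ::
    "(nat \<Rightarrow> real) \<Rightarrow> (nat \<Rightarrow> real) \<Rightarrow> real \<Rightarrow> (nat \<Rightarrow> real \<Rightarrow> 'a \<Rightarrow> real) \<Rightarrow> (nat \<Rightarrow> 'a \<Rightarrow> real) \<Rightarrow>
     real \<Rightarrow> nat \<Rightarrow> real \<Rightarrow> 'a \<Rightarrow> real" where
  "fourier_mode \<mu> q \<sigma> w u0 \<theta> k t \<omega> =
     u0 k \<omega> * exp (- (\<theta> * \<mu> k + \<sigma>\<^sup>2 * (q k)\<^sup>2 / 2) * t + \<sigma> * q k * w k t \<omega>)"

definition fisher_info :: "(nat \<Rightarrow> real) \<Rightarrow> (nat \<Rightarrow> real) \<Rightarrow> real \<Rightarrow> real \<Rightarrow> nat \<Rightarrow> real" where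
  "fisher_info \<mu> q \<sigma> T N = T / \<sigma>\<^sup>2 * (\<Sum>k=1..N. (\<mu> k)\<^sup>2 / (q k)\<^sup>2)"

text \<open>\<open>J k\<close> stands for the integral of \<open>1/u\<^sub>k\<close> against \<open>u\<^sub>k\<close> over \<open>[0,T]\<close>.\<close>

definition theta_hat ::
    "(nat \<Rightarrow> real) \<Rightarrow> (nat \<Rightarrow> real) \<Rightarrow> real \<Rightarrow> (nat \<Rightarrow> 'a \<Rightarrow> real) \<Rightarrow> nat \<Rightarrow> 'a \<Rightarrow> real" where
  "theta_hat \<mu> q T J N \<omega> =
     - ((\<Sum>k=1..N. \<mu> k / (q k)\<^sup>2 * J k \<omega>) / (T * (\<Sum>k=1..N. (\<mu> k)\<^sup>2 / (q k)\<^sup>2)))"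

section \<open>Posterior and Bayesian estimator\<close>

text \<open>The posterior depends on the observation only through the Fisher information \<open>I\<close> and the
  value \<open>h\<close> of \<open>theta_hat\<close>.\<close>

definition posterior_weight :: "(real \<Rightarrow> real) \<Rightarrow> real \<Rightarrow> real \<Rightarrow> real \<Rightarrow> real" where
  "posterior_weight \<rho> I h \<theta> = exp (- (I * (\<theta> - h)\<^sup>2 / 2)) * \<rho> \<theta>"

text \<open>Integrability has to be required separately, as the Bochner integral of a non-integrable
  function is \<open>0\<close> by convention.\<close>

definition posterior_exists :: "(real \<Rightarrow> real) \<Rightarrow> real \<Rightarrow> real \<Rightarrow> bool" where
  "posterior_exists \<rho> I h \<longleftrightarrow>
     set_integrable lborel {0<..} (posterior_weight \<rho> I h) \<and>
     0 < (LINT \<eta>:{0<..}|lborel. posterior_weight \<rho> I h \<eta>)"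

definition posterior_density :: "(real \<Rightarrow> real) \<Rightarrow> real \<Rightarrow> real \<Rightarrow> real \<Rightarrow> real" where
  "posterior_density \<rho> I h \<theta> =
     posterior_weight \<rho> I h \<theta> / (LINT \<eta>:{0<..}|lborel. posterior_weight \<rho> I h \<eta>)"

definition posterior_risk ::
    "(real \<Rightarrow> real) \<Rightarrow> (real \<Rightarrow> real) \<Rightarrow> real \<Rightarrow> real \<Rightarrow> real \<Rightarrow> ennreal" where
  "posterior_risk l \<rho> I h \<beta> =
     (\<integral>\<^sup>+\<eta>\<in>{0<..}. ennreal (l (sqrt I * (\<eta> - \<beta>)) * posterior_density \<rho> I h \<eta>) \<partial>lborel)"

definition strict_min_on :: "('b \<Rightarrow> 'c::order) \<Rightarrow> 'b set \<Rightarrow> 'b \<Rightarrow> bool" where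
  "strict_min_on f S x \<longleftrightarrow> x \<in> S \<and> (\<forall>y\<in>S. y \<noteq> x \<longrightarrow> f x < f y)"

definition bayes_well_defined :: "(real \<Rightarrow> real) \<Rightarrow> (real \<Rightarrow> real) \<Rightarrow> real \<Rightarrow> real \<Rightarrow> bool" where
  "bayes_well_defined l \<rho> I h \<longleftrightarrow> (\<exists>\<beta>. strict_min_on (posterior_risk l \<rho> I h) {0<..} \<beta>)"

text \<open>Under \<open>bayes_well_defined\<close> the minimiser chosen by \<open>arg_min_on\<close> is unique.\<close>

definition bayes_estimate :: "(real \<Rightarrow> real) \<Rightarrow> (real \<Rightarrow> real) \<Rightarrow> real \<Rightarrow> real \<Rightarrow> real" where
  "bayes_estimate l \<rho> I h = arg_min_on (posterior_risk l \<rho> I h) {0<..}"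

section \<open>Classes of priors and loss functions\<close>

text \<open>Only the values of a prior on \<open>(0,\<infinity>)\<close> matter.\<close>

definition prior_class_e2 :: "(real \<Rightarrow> real) set" where
  "prior_class_e2 =
     {\<rho>. continuous_on {0<..} \<rho> \<and> (\<forall>\<theta>>0. 0 < \<rho> \<theta>) \<and>
        (\<exists>c r. 0 < c \<and> 0 < r \<and> r < 2 \<and> \<rho> \<in> O[at_top](\<lambda>\<theta>. exp (c * \<theta> powr r)))}"

definition loss_class :: "(real \<Rightarrow> real) set" where
  "loss_class =
     {l. l \<in> borel_measurable borel \<and> (\<forall>x. 0 \<le> l x) \<and> (\<forall>x. l (- x) = l x) \<and>
        mono_on {0..} l \<and> l 0 = 0 \<and> isCont l 0 \<and> (\<exists>x. l x \<noteq> 0)}"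

definition loss_class_e2 :: "(real \<Rightarrow> real) set" where
  "loss_class_e2 =
     {l \<in> loss_class.
        \<exists>c r. 0 < c \<and> 0 < r \<and> r < 2 \<and> l \<in> O[at_infinity](\<lambda>x. exp (c * \<bar>x\<bar> powr r))}"

end

theory Submission
  imports Defs "HOL-Real_Asymp.Real_Asymp"
begin

text \<open>
Write \<open>h\<close> for the maximum likelihood estimate and \<open>I\<close> for the Fisher information.  The
argument separates into a deterministic statement about the posterior, which sees the data only
through \<open>I\<close> and \<open>h\<close>, and a probabilistic statement about \<open>h\<close>.

Deterministic part.  In the local variables \<open>\<eta> = h + x / sqrt I\<close>, \<open>\<beta> = h + r / sqrt I\<close> the posterior
risk is, up to a factor that does not involve \<open>r\<close>, the integral of
\<open>l (x - r) * exp (- x\<^sup>2 / 2) * \<rho> (h + x / sqrt I)\<close>.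
As \<open>I\<close> grows with \<open>h\<close> tending to \<open>h\<^sub>0 > 0\<close>, the risk at \<open>r = 0\<close> tends to \<open>\<rho> h\<^sub>0 * L 0\<close>, where \<open>L r\<close> is the
Gaussian integral of \<open>l (x - r)\<close> (lemma \<open>rescaled_risk_0_tendsto\<close>): the growth conditions yield a
Gaussian majorant away from \<open>\<eta> = 0\<close>, while near \<open>\<eta> = 0\<close>, where the prior may blow up, existence of
the posterior makes the prior integrable and the factor \<open>exp (- x\<^sup>2 / 2)\<close> makes the contribution
exponentially small.  For \<open>r\<close> with \<open>\<bar>r\<bar> \<ge> \<epsilon>\<close> the risk is bounded below uniformly: on a window
\<open>\<bar>x\<bar> \<le> m\<close> the prior is nearly \<open>\<rho> h\<^sub>0\<close>, and by the one-dimensional Anderson inequality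
(\<open>bowl_shift_integral_mono\<close>) the windowed Gaussian integral of \<open>l (x - r)\<close> only grows with \<open>\<bar>r\<bar>\<close>
(lemma \<open>rescaled_risk_lower_bound\<close>).  As \<open>L 0 < L \<epsilon>\<close>, a large window makes this lower bound exceed the
risk at \<open>r = 0\<close>, so a minimiser satisfies \<open>\<bar>r\<bar> < \<epsilon>\<close>.  By compactness this is uniform for \<open>h\<close> in a
compact subset of the half line (lemma \<open>bayes_estimate_near_mle\<close>).

Probabilistic part.  Formally \<open>du / u = - \<theta> \<mu> dt + \<sigma> q dw\<close>, and evaluating the Riemann sums along
uniform partitions confirms that the integral of \<open>1 / u\<close> against \<open>u\<close> is
\<open>\<sigma> q (w T - w 0) - \<theta> \<mu> T\<close> (lemma \<open>log_integral_geometric_brownian_motion\<close>).  Hence \<open>h - \<theta>\<close> is almost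
surely a random variable that does not depend on \<open>\<theta>\<close> and is centred normal with variance \<open>1 / I\<close>.
Well-posedness bounds \<open>q\<^sup>2\<close> by a multiple of \<open>\<mu>\<close>, so \<open>I\<close> grows at least linearly; fourth moments and
Borel--Cantelli then give strong consistency.  The same tail bound, being the same for all \<open>\<theta>\<close>, shows
that uniformly for \<open>\<theta>\<close> in a compact \<open>B\<close> the estimate \<open>h\<close> stays in a compact neighbourhood of \<open>B\<close> with
probability tending to one.  Both claims follow from the deterministic part.
\<close>

section \<open>Shifts of bowl-shaped losses\<close>

text \<open>Anderson's inequality in dimension one: shifting a bowl-shaped function further away from the
  centre of a unimodal weight does not decrease the weighted integral.  Recentring at the midpoint \<open>m\<close> of
  the two shifts and adding the reflected integrals turns the comparison into the pointwise
  rearrangement inequality \<open>(l (y - d) - l (y + d)) * (\<phi> (y + m) - \<phi> (y - m)) \<ge> 0\<close>.\<close>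

lemma bowl_shift_integral_mono:
  fixes l \<phi> :: "real \<Rightarrow> real"
  assumes [measurable]: "l \<in> borel_measurable borel" "\<phi> \<in> borel_measurable borel"
    and l_nonneg: "\<And>x. 0 \<le> l x" and \<phi>_nonneg: "\<And>x. 0 \<le> \<phi> x"
    and l_mono: "\<And>x y. \<bar>x\<bar> \<le> \<bar>y\<bar> \<Longrightarrow> l x \<le> l y"
    and \<phi>_mono: "\<And>x y. \<bar>x\<bar> \<le> \<bar>y\<bar> \<Longrightarrow> \<phi> y \<le> \<phi> x"
    and rs: "\<bar>s\<bar> \<le> \<bar>r\<bar>"
  shows "(\<integral>\<^sup>+x. ennreal (l (x - s) * \<phi> x) \<partial>lborel) \<le> (\<integral>\<^sup>+x. ennreal (l (x - r) * \<phi> x) \<partial>lborel)"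
proof -
  define d m where "d = (r - s) / 2" and "m = (r + s) / 2"
  have dm: "d * m \<ge> 0"
  proof -
    have "s\<^sup>2 \<le> r\<^sup>2" using rs by (simp add: abs_le_square_iff)
    then show ?thesis by (simp add: d_def m_def field_simps power2_eq_square)
  qed
  have sym_l: "l (- x) = l x" and sym_\<phi>: "\<phi> (- x) = \<phi> x" for x
    using l_mono[of x "-x"] l_mono[of "-x" x] \<phi>_mono[of x "-x"] \<phi>_mono[of "-x" x] by auto
  \<comment> \<open>Twice the integral of \<open>l (x + a) * \<phi> x\<close>, written with \<open>x = m + y\<close> and with \<open>x = m - y\<close>.\<close>
  have doubled: "(\<integral>\<^sup>+x. ennreal (l (x + a) * \<phi> x) \<partial>lborel) * 2 =
      (\<integral>\<^sup>+y. ennreal (l (y + (m + a)) * \<phi> (y + m) + l (y - (m + a)) * \<phi> (y - m)) \<partial>lborel)" for a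
  proof -
    have 1: "(\<integral>\<^sup>+x. ennreal (l (x + a) * \<phi> x) \<partial>lborel)
        = (\<integral>\<^sup>+y. ennreal (l (y + (m + a)) * \<phi> (y + m)) \<partial>lborel)"
      by (subst nn_integral_real_affine[where c = 1 and t = m]) (simp_all add: algebra_simps)
    have 2: "(\<integral>\<^sup>+x. ennreal (l (x + a) * \<phi> x) \<partial>lborel)
        = (\<integral>\<^sup>+y. ennreal (l (y - (m + a)) * \<phi> (y - m)) \<partial>lborel)"
    proof (subst nn_integral_real_affine[where c = "-1" and t = m])
      have "l (m + -1 * y + a) = l (y - (m + a))" "\<phi> (m + -1 * y) = \<phi> (y - m)" for y
        using sym_l[of "y - (m + a)"] sym_\<phi>[of "y - m"] by (simp_all add: algebra_simps)
      then show "ennreal \<bar>-1\<bar> * (\<integral>\<^sup>+ x. ennreal (l (m + -1 * x + a) * \<phi> (m + -1 * x)) \<partial>lborel)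
        = (\<integral>\<^sup>+y. ennreal (l (y - (m + a)) * \<phi> (y - m)) \<partial>lborel)"
        by simp
    qed auto
    have "(\<integral>\<^sup>+x. ennreal (l (x + a) * \<phi> x) \<partial>lborel) * 2
        = (\<integral>\<^sup>+x. ennreal (l (x + a) * \<phi> x) \<partial>lborel) + (\<integral>\<^sup>+x. ennreal (l (x + a) * \<phi> x) \<partial>lborel)"
      by (simp add: mult_2_right)
    also have "\<dots> = (\<integral>\<^sup>+y. ennreal (l (y + (m + a)) * \<phi> (y + m)) \<partial>lborel)
        + (\<integral>\<^sup>+y. ennreal (l (y - (m + a)) * \<phi> (y - m)) \<partial>lborel)"
      using 1 2 by simp
    also have "\<dots> = (\<integral>\<^sup>+y. ennreal (l (y + (m + a)) * \<phi> (y + m) + l (y - (m + a)) * \<phi> (y - m)) \<partial>lborel)"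
      by (subst nn_integral_add[symmetric]) (auto simp: l_nonneg \<phi>_nonneg)
    finally show ?thesis .
  qed
  have ms: "m + - s = d" "m + - r = - d" by (auto simp: d_def m_def field_simps)
  have pointwise: "l (y + d) * \<phi> (y + m) + l (y - d) * \<phi> (y - m)
      \<le> l (y - d) * \<phi> (y + m) + l (y + d) * \<phi> (y - m)" for y
  proof -
    \<comment> \<open>The signs of \<open>y * d\<close> and \<open>y * m\<close> agree, so both factors of the rearrangement have the same sign.\<close>
    have sgn: "0 \<le> (y * d) * (y * m)"
      using mult_nonneg_nonneg[OF zero_le_square[of y] dm] by (simp add: algebra_simps)
    have plus: "z * c \<ge> 0 \<Longrightarrow> \<bar>z - c\<bar> \<le> \<bar>z + c\<bar>" and minus: "z * c \<le> 0 \<Longrightarrow> \<bar>z + c\<bar> \<le> \<bar>z - c\<bar>"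
      for z c :: real
      by (auto simp: abs_le_square_iff power2_eq_square algebra_simps)
    have "0 \<le> (l (y - d) - l (y + d)) * (\<phi> (y + m) - \<phi> (y - m))"
    proof (cases "y * d = 0")
      case True
      then have "l (y - d) = l (y + d)"
        using sym_l[of d] by (auto)
      then show ?thesis by simp
    next
      case False
      then consider "y * d > 0" "y * m \<ge> 0" | "y * d < 0" "y * m \<le> 0"
        using sgn by (metis less_linear mult_less_cancel_left_pos mult_zero_right
            not_less zero_le_mult_iff)
      then show ?thesis
      proof cases
        case 1
        then show ?thesis
          using l_mono[OF plus[of y d]] \<phi>_mono[OF plus[of y m]]
          by (intro mult_nonpos_nonpos) auto
      next
        case 2
        then show ?thesis
          using l_mono[OF minus[of y d]] \<phi>_mono[OF minus[of y m]]
          by (intro mult_nonneg_nonneg) auto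
      qed
    qed
    then show ?thesis by (simp add: algebra_simps)
  qed
  have "(\<integral>\<^sup>+x. ennreal (l (x + - s) * \<phi> x) \<partial>lborel) * 2 \<le> (\<integral>\<^sup>+x. ennreal (l (x + - r) * \<phi> x) \<partial>lborel) * 2"
    unfolding doubled ms using pointwise by (intro nn_integral_mono ennreal_leI) auto
  then show ?thesis
    by (simp add: mult.commute[of _ 2] ennreal_mult_le_mult_iff)
qed

section \<open>Growth bounds for losses and priors\<close>

lemma subquadratic_power_le:
  fixes c e r :: real
  assumes "0 < r" "r < 2" "0 < e"
  shows "eventually (\<lambda>x. c * x powr r \<le> e * x\<^sup>2) at_top"
proof -
  have "((\<lambda>x. c * x powr r / x\<^sup>2) \<longlongrightarrow> 0) at_top" using assms by real_asymp
  then have "eventually (\<lambda>x. c * x powr r / x\<^sup>2 < e) at_top"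
    using assms by (auto dest: order_tendstoD)
  with eventually_gt_at_top[of 0] show ?thesis
    by eventually_elim (simp add: field_simps)
qed

lemma loss_mono_abs:
  assumes "l \<in> loss_class" "\<bar>x\<bar> \<le> \<bar>y\<bar>"
  shows "l x \<le> l y"
proof -
  have a: "l \<bar>z\<bar> = l z" for z using assms(1) by (auto simp: loss_class_def abs_if)
  have "l \<bar>x\<bar> \<le> l \<bar>y\<bar>"
    using assms by (auto simp: loss_class_def intro: mono_onD)
  then show ?thesis by (simp add: a)
qed

text \<open>Exponents \<open>r < 2\<close> are absorbed by an arbitrarily small multiple of \<open>x\<^sup>2\<close>; monotonicity controls
  the loss on bounded sets, so that the bound holds everywhere.\<close>

lemma loss_le_exp_square:
  assumes l: "l \<in> loss_class_e2" and e: "0 < e"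
  obtains A where "0 < A" "\<And>x. l x \<le> A * exp (e * x\<^sup>2)"
proof -
  from l obtain c r where lc: "l \<in> loss_class" and cr: "0 < c" "0 < r" "r < 2"
    and O: "l \<in> O[at_infinity](\<lambda>x. exp (c * \<bar>x\<bar> powr r))" by (auto simp: loss_class_e2_def)
  from O obtain K where K: "0 < K"
    "eventually (\<lambda>x. norm (l x) \<le> K * norm (exp (c * \<bar>x\<bar> powr r))) at_infinity"
    by (elim landau_o.bigE)
  then obtain b where b: "\<And>x. b \<le> norm x \<Longrightarrow> norm (l x) \<le> K * norm (exp (c * \<bar>x\<bar> powr r))"
    by (auto simp: eventually_at_infinity)
  obtain X where X: "\<And>x. X \<le> x \<Longrightarrow> c * x powr r \<le> e * x\<^sup>2"
    using subquadratic_power_le[OF cr(2,3) e, of c] by (auto simp: eventually_at_top_linorder)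
  define B where "B = max \<bar>b\<bar> \<bar>X\<bar>"
  have lB: "0 \<le> l B" using lc by (auto simp: loss_class_def)
  show thesis
  proof
    show "0 < K + l B" using K lB by simp
    fix x
    show "l x \<le> (K + l B) * exp (e * x\<^sup>2)"
    proof (cases "B \<le> \<bar>x\<bar>")
      case True
      then have "l x \<le> K * exp (c * \<bar>x\<bar> powr r)" using b[of x] abs_ge_self[of b] abs_ge_self[of "l x"] by (simp add: B_def)
      also have "\<dots> \<le> K * exp (e * x\<^sup>2)"
        using X[of "\<bar>x\<bar>"] True K by (intro mult_left_mono) (auto simp: B_def)
      also have "\<dots> \<le> (K + l B) * exp (e * x\<^sup>2)" using lB by (intro mult_right_mono) auto
      finally show ?thesis .
    next
      case False
      then have "l x \<le> l B" by (intro loss_mono_abs[OF lc]) (auto simp: B_def)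
      also have "\<dots> \<le> K + l B" using K by simp
      also have "\<dots> \<le> (K + l B) * exp (e * x\<^sup>2)"
        using K lB e by (subst mult_le_cancel_left1) auto
      finally show ?thesis .
    qed
  qed
qed

text \<open>The restriction to \<open>\<delta> \<le> \<theta>\<close> cannot be dropped, as a prior may be unbounded near \<open>0\<close>.\<close>

lemma prior_le_exp_square:
  assumes \<rho>: "\<rho> \<in> prior_class_e2" and e: "0 < e" and \<delta>: "0 < \<delta>"
  obtains A where "0 < A" "\<And>\<theta>. \<delta> \<le> \<theta> \<Longrightarrow> \<rho> \<theta> \<le> A * exp (e * \<theta>\<^sup>2)"
proof -
  from \<rho> obtain c r where cont: "continuous_on {0<..} \<rho>" and cr: "0 < c" "0 < r" "r < 2"
    and O: "\<rho> \<in> O[at_top](\<lambda>x. exp (c * x powr r))" by (auto simp: prior_class_e2_def)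
  from O obtain K where K: "0 < K"
    "eventually (\<lambda>x. norm (\<rho> x) \<le> K * norm (exp (c * x powr r))) at_top"
    by (elim landau_o.bigE)
  from K(2) subquadratic_power_le[OF cr(2,3) e, of c]
  have "eventually (\<lambda>x. \<rho> x \<le> K * exp (e * x\<^sup>2)) at_top"
  proof eventually_elim
    case (elim x)
    then have "\<rho> x \<le> K * exp (c * x powr r)" by auto
    also have "\<dots> \<le> K * exp (e * x\<^sup>2)" using elim K by (intro mult_left_mono) auto
    finally show ?case .
  qed
  then obtain B where B: "\<And>x. B \<le> x \<Longrightarrow> \<rho> x \<le> K * exp (e * x\<^sup>2)"
    by (auto simp: eventually_at_top_linorder)
  have "compact (\<rho> ` {\<delta>..B})"
    using \<delta> by (intro compact_continuous_image continuous_on_subset[OF cont]) auto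
  then obtain C where C: "\<And>x. x \<in> {\<delta>..B} \<Longrightarrow> \<bar>\<rho> x\<bar> \<le> C" 
    by (fastforce dest!: compact_imp_bounded simp: bounded_iff)
  show thesis
  proof
    show "0 < K + \<bar>C\<bar>" using K by simp
    fix x assume x: "\<delta> \<le> x"
    have "\<rho> x \<le> K * exp (e * x\<^sup>2) \<or> \<rho> x \<le> \<bar>C\<bar> * 1" using B[of x] C[of x] x by (cases "B \<le> x") auto
    moreover have "K * exp (e * x\<^sup>2) \<le> (K + \<bar>C\<bar>) * exp (e * x\<^sup>2)" by (intro mult_right_mono) auto
    moreover have "\<bar>C\<bar> * 1 \<le> (K + \<bar>C\<bar>) * exp (e * x\<^sup>2)" using K e by (intro mult_mono) auto
    ultimately show "\<rho> x \<le> (K + \<bar>C\<bar>) * exp (e * x\<^sup>2)" by linarith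
  qed
qed

section \<open>The posterior risk in local coordinates\<close>

text \<open>Extension by zero: the values of a prior off the half line are arbitrary, even non-measurable.\<close>

definition prior_ext :: "(real \<Rightarrow> real) \<Rightarrow> real \<Rightarrow> real" where
  "prior_ext \<rho> \<theta> = indicator {0<..} \<theta> * \<rho> \<theta>"

text \<open>The posterior risk as a function of \<open>r = sqrt I * (\<beta> - h)\<close>, without the constant factor,
  and with the integration variable \<open>x = sqrt I * (\<eta> - h)\<close>.\<close>

definition rescaled_risk :: "(real \<Rightarrow> real) \<Rightarrow> (real \<Rightarrow> real) \<Rightarrow> real \<Rightarrow> real \<Rightarrow> real \<Rightarrow> ennreal" where
  "rescaled_risk l \<rho> I h r =
     (\<integral>\<^sup>+x. ennreal (l (x - r) * exp (- (x\<^sup>2 / 2)) * prior_ext \<rho> (h + x / sqrt I)) \<partial>lborel)"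

lemma prior_ext_measurable:
  assumes "\<rho> \<in> prior_class_e2"
  shows "prior_ext \<rho> \<in> borel_measurable borel"
  using borel_measurable_continuous_on_indicator[of "{0<..}" \<rho>] assms
  by (simp add: prior_class_e2_def prior_ext_def[abs_def])

lemma prior_ext_nonneg: "\<rho> \<in> prior_class_e2 \<Longrightarrow> 0 \<le> prior_ext \<rho> \<theta>"
  by (auto simp: prior_class_e2_def prior_ext_def indicator_def less_imp_le)

lemma posterior_risk_rescale:
  assumes \<rho>: "\<rho> \<in> prior_class_e2" and [measurable]: "l \<in> borel_measurable borel"
    and l_nonneg: "\<And>x. 0 \<le> l x"
    and I: "0 < I" and pe: "posterior_exists \<rho> I h"
  obtains K where "0 < K"
    "\<And>r. posterior_risk l \<rho> I h (h + r / sqrt I) = ennreal K * rescaled_risk l \<rho> I h r"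
proof -
  note [measurable] = prior_ext_measurable[OF \<rho>]
  define Z where "Z = (LINT \<eta>:{0<..}|lborel. posterior_weight \<rho> I h \<eta>)"
  have Z: "0 < Z" using pe by (simp add: posterior_exists_def Z_def)
  have "posterior_risk l \<rho> I h (h + r / sqrt I) = ennreal (1 / (Z * sqrt I)) * rescaled_risk l \<rho> I h r" for r
  proof -
    let ?b = "h + r / sqrt I"
    have sI: "sqrt I > 0" using I by simp
    have "posterior_risk l \<rho> I h ?b = (\<integral>\<^sup>+\<eta>. ennreal (l (sqrt I * (\<eta> - ?b)) *
        (exp (- (I * (\<eta> - h)\<^sup>2 / 2)) * prior_ext \<rho> \<eta> / Z)) \<partial>lborel)"
      unfolding posterior_risk_def posterior_density_def Z_def[symmetric]
      by (intro nn_integral_cong) (auto simp: posterior_weight_def prior_ext_def indicator_def)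
    also have "\<dots> = \<bar>1 / sqrt I\<bar> * (\<integral>\<^sup>+x. ennreal (l (sqrt I * ((h + 1 / sqrt I * x) - ?b)) *
        (exp (- (I * ((h + 1 / sqrt I * x) - h)\<^sup>2 / 2)) * prior_ext \<rho> (h + 1 / sqrt I * x) / Z)) \<partial>lborel)"
      using sI by (intro nn_integral_real_affine) auto
    also have "\<dots> = \<bar>1 / sqrt I\<bar> * (\<integral>\<^sup>+x. ennreal (1 / Z) *
        ennreal (l (x - r) * exp (- (x\<^sup>2 / 2)) * prior_ext \<rho> (h + x / sqrt I)) \<partial>lborel)"
    proof (intro arg_cong2[where f = "(*)"] refl nn_integral_cong)
      fix x
      have 1: "sqrt I * ((h + 1 / sqrt I * x) - ?b) = x - r" using sI by (simp add: field_simps)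
      have 2: "I * ((h + 1 / sqrt I * x) - h)\<^sup>2 = x\<^sup>2" using I by (simp add: power_divide)
      show "ennreal (l (sqrt I * ((h + 1 / sqrt I * x) - ?b)) *
        (exp (- (I * ((h + 1 / sqrt I * x) - h)\<^sup>2 / 2)) * prior_ext \<rho> (h + 1 / sqrt I * x) / Z))
        = ennreal (1 / Z) * ennreal (l (x - r) * exp (- (x\<^sup>2 / 2)) * prior_ext \<rho> (h + x / sqrt I))"
        unfolding 1 2 using Z by (subst ennreal_mult'[symmetric]) (auto simp: field_simps)
    qed
    also have "\<dots> = ennreal \<bar>1 / sqrt I\<bar> * (ennreal (1 / Z) * rescaled_risk l \<rho> I h r)"
      unfolding rescaled_risk_def by (subst nn_integral_cmult) auto
    also have "\<dots> = ennreal (1 / (Z * sqrt I)) * rescaled_risk l \<rho> I h r"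
      using sI Z by (simp add: mult.assoc[symmetric] ennreal_mult'[symmetric] mult.commute)
    finally show ?thesis .
  qed
  moreover have "0 < 1 / (Z * sqrt I)" using Z I by simp
  ultimately show thesis by (rule that[rotated])
qed

lemma bayes_estimate_minimises:
  assumes "bayes_well_defined l \<rho> I h" and "0 < \<beta>"
  shows "posterior_risk l \<rho> I h (bayes_estimate l \<rho> I h) \<le> posterior_risk l \<rho> I h \<beta>"
proof -
  let ?R = "posterior_risk l \<rho> I h"
  obtain b where b: "strict_min_on ?R {0<..} b" using assms(1) by (auto simp: bayes_well_defined_def)
  have "is_arg_min ?R (\<lambda>x. x \<in> {0<..}) b"
    using b by (force simp: strict_min_on_def is_arg_min_def)
  then have "is_arg_min ?R (\<lambda>x. x \<in> {0<..}) (bayes_estimate l \<rho> I h)"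
    unfolding bayes_estimate_def arg_min_on_def arg_min_def by (rule someI)
  then show ?thesis using assms(2) by (force simp: is_arg_min_def not_less)
qed

lemma rescaled_risk_bayes_le:
  assumes \<rho>: "\<rho> \<in> prior_class_e2" and l: "l \<in> loss_class"
    and I: "0 < I" and h: "0 < h"
    and pe: "posterior_exists \<rho> I h" and bw: "bayes_well_defined l \<rho> I h"
  shows "rescaled_risk l \<rho> I h (sqrt I * (bayes_estimate l \<rho> I h - h)) \<le> rescaled_risk l \<rho> I h 0"
proof -
  have "l \<in> borel_measurable borel" "\<And>x. 0 \<le> l x" using l by (auto simp: loss_class_def)
  from posterior_risk_rescale[OF \<rho> this I pe] obtain K where K: "0 < K"
    "\<And>r. posterior_risk l \<rho> I h (h + r / sqrt I) = ennreal K * rescaled_risk l \<rho> I h r"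
    by blast
  let ?b = "bayes_estimate l \<rho> I h"
  have "posterior_risk l \<rho> I h (h + (sqrt I * (?b - h)) / sqrt I) \<le> posterior_risk l \<rho> I h (h + 0 / sqrt I)"
    using bayes_estimate_minimises[OF bw h] I by simp
  then show ?thesis unfolding K(2) using K(1)
    by (simp add: ennreal_mult_le_mult_iff)
qed

text \<open>On bounded sets the Gaussian factor of the posterior is bounded away from \<open>0\<close>, so integrability
  of the posterior weight passes to the prior itself.  This is the only information available about
  the prior near \<open>0\<close>.\<close>

lemma posterior_exists_prior_integrable_near_0:
  assumes \<rho>: "\<rho> \<in> prior_class_e2" and I: "0 \<le> I" and pe: "posterior_exists \<rho> I h"
  shows "(\<integral>\<^sup>+\<theta>. ennreal (indicator {..\<delta>} \<theta> * prior_ext \<rho> \<theta>) \<partial>lborel) < \<infinity>"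
proof -
  note [measurable] = prior_ext_measurable[OF \<rho>]
  define m where "m = exp (- (I * (\<bar>\<delta>\<bar> + \<bar>h\<bar>)\<^sup>2 / 2))"
  have m: "m > 0" by (simp add: m_def)
  let ?w = "\<lambda>\<theta>. indicator {0<..} \<theta> *\<^sub>R posterior_weight \<rho> I h \<theta>"
  have "integrable lborel ?w" using pe by (simp add: posterior_exists_def set_integrable_def)
  then have w: "(\<integral>\<^sup>+\<theta>. ennreal (norm (?w \<theta>)) \<partial>lborel) < \<infinity>" by (simp add: integrable_iff_bounded)
  have "(\<integral>\<^sup>+\<theta>. ennreal (indicator {..\<delta>} \<theta> * prior_ext \<rho> \<theta>) \<partial>lborel) \<le>
    (\<integral>\<^sup>+\<theta>. ennreal (1 / m) * ennreal (norm (?w \<theta>)) \<partial>lborel)"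
  proof (intro nn_integral_mono)
    fix \<theta>
    show "ennreal (indicator {..\<delta>} \<theta> * prior_ext \<rho> \<theta>) \<le> ennreal (1 / m) * ennreal (norm (?w \<theta>))"
    proof (cases "\<theta> \<in> {0<..\<delta>}")
      case True
      have p: "0 \<le> \<rho> \<theta>" using prior_ext_nonneg[OF \<rho>, of \<theta>] True by (simp add: prior_ext_def)
      have "(\<theta> - h)\<^sup>2 \<le> (\<bar>\<delta>\<bar> + \<bar>h\<bar>)\<^sup>2" using True by (intro abs_le_square_iff[THEN iffD1]) auto
      then have "m \<le> exp (- (I * (\<theta> - h)\<^sup>2 / 2))" using I by (auto simp: m_def mult_left_mono)
      then have "m * \<rho> \<theta> \<le> norm (?w \<theta>)"
        using True p by (auto simp: posterior_weight_def abs_mult intro: mult_right_mono)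
      then have "indicator {..\<delta>} \<theta> * prior_ext \<rho> \<theta> \<le> (1 / m) * norm (?w \<theta>)"
        using True m by (simp add: prior_ext_def field_simps)
      then have "ennreal (indicator {..\<delta>} \<theta> * prior_ext \<rho> \<theta>) \<le> ennreal ((1 / m) * norm (?w \<theta>))"
        by (rule ennreal_leI)
      also have "\<dots> = ennreal (1 / m) * ennreal (norm (?w \<theta>))"
        using m by (subst ennreal_mult'[symmetric]) auto
      finally show ?thesis .
    next
      case False
      then have "indicator {..\<delta>} \<theta> * prior_ext \<rho> \<theta> = 0" by (auto simp: prior_ext_def indicator_def)
      then show ?thesis by (simp only: ennreal_0 zero_le)
    qed
  qed
  also have "\<dots> = ennreal (1 / m) * (\<integral>\<^sup>+\<theta>. ennreal (norm (?w \<theta>)) \<partial>lborel)"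
  proof (rule nn_integral_cmult)
    have "?w \<in> borel_measurable lborel" using \<open>integrable lborel ?w\<close> by (rule borel_measurable_integrable)
    then show "(\<lambda>\<theta>. ennreal (norm (?w \<theta>))) \<in> borel_measurable lborel" by measurable
  qed
  also have "\<dots> < \<infinity>" using w by (simp add: ennreal_mult_less_top)
  finally show ?thesis .
qed

section \<open>Convergence and lower bounds of the rescaled risk\<close>

lemma nn_integral_exp_square_finite:
  assumes "0 < a"
  shows "(\<integral>\<^sup>+x. ennreal (C * exp (- (a * x\<^sup>2))) \<partial>lborel) < \<infinity>"
proof -
  define s where "s = sqrt (1 / (2 * a))"
  have s: "s > 0" "s\<^sup>2 = 1 / (2 * a)" using assms by (auto simp: s_def)
  have "integrable lborel (\<lambda>x. (C * sqrt (2 * pi * s\<^sup>2)) * normal_density 0 s x)"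
    using s by (intro integrable_mult_right integrable_normal_density)
  also have "(\<lambda>x. (C * sqrt (2 * pi * s\<^sup>2)) * normal_density 0 s x) = (\<lambda>x. C * exp (- (a * x\<^sup>2)))"
    using s assms by (auto simp: normal_density_def fun_eq_iff field_simps)
  finally have "(\<integral>\<^sup>+x. ennreal (norm (C * exp (- (a * x\<^sup>2)))) \<partial>lborel) < \<infinity>"
    by (simp only: integrable_iff_bounded)
  then show ?thesis
    by (rule le_less_trans[rotated]) (intro nn_integral_mono ennreal_leI, simp)
qed

lemma prior_ext_tendsto:
  assumes \<rho>: "\<rho> \<in> prior_class_e2" and y: "(y \<longlongrightarrow> h0) F" and h0: "0 < h0"
  shows "((\<lambda>n. prior_ext \<rho> (y n)) \<longlongrightarrow> \<rho> h0) F"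
proof -
  have "isCont \<rho> h0"
    using \<rho> h0 by (auto simp: prior_class_e2_def continuous_on_eq_continuous_at)
  then have "((\<lambda>n. \<rho> (y n)) \<longlongrightarrow> \<rho> h0) F" using y by (rule isCont_tendsto_compose)
  moreover have "eventually (\<lambda>n. y n > 0) F" using y h0 by (rule order_tendstoD)
  then have "eventually (\<lambda>n. \<rho> (y n) = prior_ext \<rho> (y n)) F"
    by eventually_elim (simp add: prior_ext_def)
  ultimately show ?thesis by (rule Lim_transform_eventually)
qed

context
  fixes \<rho> l :: "real \<Rightarrow> real" and I h :: "nat \<Rightarrow> real" and h0 :: real
  assumes \<rho>: "\<rho> \<in> prior_class_e2" and l: "l \<in> loss_class_e2"
    and I_lim: "filterlim I at_top sequentially" and I1: "\<And>n. 1 \<le> I n"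
    and h_lim: "h \<longlonglongrightarrow> h0" and h0: "0 < h0" and h_bd: "\<And>n. h n \<in> {h0 / 2..2 * h0}"
begin

lemma loss_in_class: "l \<in> loss_class" and loss_measurable: "l \<in> borel_measurable borel"
  and loss_nonneg: "0 \<le> l x"
  using l by (auto simp: loss_class_e2_def loss_class_def)

lemma local_point_tendsto: "(\<lambda>n. h n + x / sqrt (I n)) \<longlonglongrightarrow> h0"
proof -
  have "filterlim (\<lambda>n. sqrt (I n)) at_top sequentially"
    using sqrt_at_top I_lim by (rule filterlim_compose)
  then have "(\<lambda>n. x / sqrt (I n)) \<longlonglongrightarrow> 0"
    by (intro real_tendsto_divide_at_top[OF tendsto_const])
  from tendsto_add[OF h_lim this] show ?thesis by simp
qed

text \<open>Dominated convergence: the loss costs at most a factor \<open>exp (x\<^sup>2 / 16)\<close> and, away from \<open>\<eta> = 0\<close>, the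
  prior a factor \<open>exp (\<eta>\<^sup>2 / 16)\<close> with \<open>\<eta>\<^sup>2 \<le> 8 * h0\<^sup>2 + 2 * x\<^sup>2\<close>, which leaves the Gaussian majorant
  \<open>exp (- x\<^sup>2 / 4)\<close>.\<close>

lemma rescaled_risk_bulk_tendsto:
  assumes \<delta>: "0 < \<delta>" "\<delta> < h0"
  shows "(\<lambda>n. \<integral>\<^sup>+x. ennreal (l x * exp (- (x\<^sup>2 / 2)) *
            (indicator {\<delta><..} (h n + x / sqrt (I n)) * prior_ext \<rho> (h n + x / sqrt (I n)))) \<partial>lborel)
         \<longlonglongrightarrow> (\<integral>\<^sup>+x. ennreal (l x * exp (- (x\<^sup>2 / 2)) * \<rho> h0) \<partial>lborel)"
proof -
  note [measurable] = loss_measurable prior_ext_measurable[OF \<rho>]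
  obtain A where A: "0 < A" "\<And>x. l x \<le> A * exp (1 / 16 * x\<^sup>2)"
    using loss_le_exp_square[OF l, of "1 / 16"] by auto
  obtain A' where A': "0 < A'" "\<And>x. \<delta> \<le> x \<Longrightarrow> \<rho> x \<le> A' * exp (1 / 16 * x\<^sup>2)"
    using prior_le_exp_square[OF \<rho> _ \<delta>(1), of "1 / 16"] by auto
  define C where "C = A * A' * exp (h0\<^sup>2 / 2)"
  have bound: "l x * exp (- (x\<^sup>2 / 2)) * (indicator {\<delta><..} (h n + x / sqrt (I n)) *
      prior_ext \<rho> (h n + x / sqrt (I n))) \<le> C * exp (- (1 / 4 * x\<^sup>2))" for n x
  proof (cases "\<delta> < h n + x / sqrt (I n)")
    case True
    let ?y = "h n + x / sqrt (I n)"
    have "(x / sqrt (I n))\<^sup>2 \<le> x\<^sup>2" using I1[of n] 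
      by (simp add: power_divide divide_le_eq mult_right_mono) (smt (verit) mult_le_cancel_left1 zero_le_power2)
    moreover have "?y\<^sup>2 \<le> 2 * (h n)\<^sup>2 + 2 * (x / sqrt (I n))\<^sup>2" 
      using sum_squares_bound[of "h n" "x / sqrt (I n)"] by (simp add: power2_sum)
    moreover have "(h n)\<^sup>2 \<le> (2 * h0)\<^sup>2" using h_bd[of n] h0 by (intro power_mono) auto
    ultimately have y2: "?y\<^sup>2 \<le> 8 * h0\<^sup>2 + 2 * x\<^sup>2" by (simp add: power_mult_distrib)
    have "prior_ext \<rho> ?y \<le> A' * exp (1 / 16 * ?y\<^sup>2)" using A'(2)[of ?y] True \<delta> by (simp add: prior_ext_def)
    also have "\<dots> \<le> A' * exp (h0\<^sup>2 / 2 + x\<^sup>2 / 8)" using A'(1) y2 by simp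
    finally have p: "prior_ext \<rho> ?y \<le> A' * exp (h0\<^sup>2 / 2 + x\<^sup>2 / 8)" .
    have "l x * exp (- (x\<^sup>2 / 2)) * prior_ext \<rho> ?y
        \<le> (A * exp (1 / 16 * x\<^sup>2)) * exp (- (x\<^sup>2 / 2)) * (A' * exp (h0\<^sup>2 / 2 + x\<^sup>2 / 8))"
      using A p loss_nonneg prior_ext_nonneg[OF \<rho>] by (intro mult_mono) auto
    also have "\<dots> = C * exp (- (5 / 16 * x\<^sup>2))"
      by (simp add: C_def mult_exp_exp)
    also have "\<dots> \<le> C * exp (- (1 / 4 * x\<^sup>2))" using A A' by (auto simp: C_def intro!: mult_left_mono)
    finally show ?thesis using True by simp
  next
    case False
    then show ?thesis using A A' by (simp add: C_def)
  qed
  show ?thesis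
  proof (rule nn_integral_dominated_convergence[where w = "\<lambda>x. ennreal (C * exp (- (1 / 4 * x\<^sup>2)))"])
    show "AE x in lborel. ennreal (l x * exp (- (x\<^sup>2 / 2)) * (indicator {\<delta><..} (h j + x / sqrt (I j)) *
      prior_ext \<rho> (h j + x / sqrt (I j)))) \<le> ennreal (C * exp (- (1 / 4 * x\<^sup>2)))" for j
      using bound by (intro AE_I2 ennreal_leI)
    show "(\<integral>\<^sup>+x. ennreal (C * exp (- (1 / 4 * x\<^sup>2))) \<partial>lborel) < \<infinity>"
      by (rule nn_integral_exp_square_finite) simp
    show "AE x in lborel. (\<lambda>n. ennreal (l x * exp (- (x\<^sup>2 / 2)) *
            (indicator {\<delta><..} (h n + x / sqrt (I n)) * prior_ext \<rho> (h n + x / sqrt (I n)))))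
            \<longlonglongrightarrow> ennreal (l x * exp (- (x\<^sup>2 / 2)) * \<rho> h0)"
    proof (intro AE_I2 tendsto_ennrealI tendsto_mult[OF tendsto_const])
      fix x
      have "(\<lambda>n. prior_ext \<rho> (h n + x / sqrt (I n))) \<longlonglongrightarrow> \<rho> h0"
        by (rule prior_ext_tendsto[OF \<rho> local_point_tendsto h0])
      moreover have "\<forall>\<^sub>F n in sequentially. \<delta> < h n + x / sqrt (I n)"
        using local_point_tendsto \<delta>(2) by (rule order_tendstoD)
      then have "\<forall>\<^sub>F n in sequentially. prior_ext \<rho> (h n + x / sqrt (I n)) =
        indicator {\<delta><..} (h n + x / sqrt (I n)) * prior_ext \<rho> (h n + x / sqrt (I n))"
        by eventually_elim simp
      ultimately show "(\<lambda>n. indicator {\<delta><..} (h n + x / sqrt (I n)) * prior_ext \<rho> (h n + x / sqrt (I n)))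
        \<longlonglongrightarrow> \<rho> h0" by (rule Lim_transform_eventually)
    qed
  qed measurable
qed

text \<open>If \<open>h + x / sqrt I \<le> h0 / 4\<close> while \<open>h \<ge> h0 / 2\<close>, then \<open>x\<^sup>2\<close> is at least a multiple of \<open>I\<close>.  The
  Gaussian factor is then exponentially small in \<open>I\<close> and beats the factor \<open>sqrt I\<close> that comes from
  changing variables back to \<open>\<eta>\<close>, where the prior is integrable.\<close>

lemma rescaled_risk_near_0_tendsto:
  assumes fin: "(\<integral>\<^sup>+\<theta>. ennreal (indicator {..h0 / 4} \<theta> * prior_ext \<rho> \<theta>) \<partial>lborel) < \<infinity>"
  shows "(\<lambda>n. \<integral>\<^sup>+x. ennreal (l x * exp (- (x\<^sup>2 / 2)) *
            (indicator {..h0 / 4} (h n + x / sqrt (I n)) * prior_ext \<rho> (h n + x / sqrt (I n)))) \<partial>lborel)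
         \<longlonglongrightarrow> 0"
proof -
  note [measurable] = loss_measurable prior_ext_measurable[OF \<rho>]
  obtain A where A: "0 < A" "\<And>x. l x \<le> A * exp (1 / 4 * x\<^sup>2)"
    using loss_le_exp_square[OF l, of "1 / 4"] by auto
  define \<delta> where "\<delta> = h0 / 4"
  have \<delta>: "0 < \<delta>" using h0 by (simp add: \<delta>_def)
  define P where "P = (\<integral>\<^sup>+\<theta>. ennreal (indicator {..\<delta>} \<theta> * prior_ext \<rho> \<theta>) \<partial>lborel)"
  have le: "(\<integral>\<^sup>+x. ennreal (l x * exp (- (x\<^sup>2 / 2)) *
            (indicator {..\<delta>} (h n + x / sqrt (I n)) * prior_ext \<rho> (h n + x / sqrt (I n)))) \<partial>lborel)
         \<le> ennreal (A * sqrt (I n) * exp (- (\<delta>\<^sup>2 / 4 * I n))) * P" (is "?L n \<le> _") for n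
  proof -
    have sI: "sqrt (I n) > 0" using I1[of n] by simp
    have P: "P = \<bar>1 / sqrt (I n)\<bar> * (\<integral>\<^sup>+x. ennreal (indicator {..\<delta>} (h n + x / sqrt (I n)) *
        prior_ext \<rho> (h n + x / sqrt (I n))) \<partial>lborel)" (is "_ = _ * ?Q")
      unfolding P_def using sI
      by (subst nn_integral_real_affine[where c = "1 / sqrt (I n)" and t = "h n"]) auto
    have "?L n \<le> (\<integral>\<^sup>+x. ennreal (A * exp (- (\<delta>\<^sup>2 / 4 * I n))) * ennreal (indicator {..\<delta>} (h n + x / sqrt (I n)) *
        prior_ext \<rho> (h n + x / sqrt (I n))) \<partial>lborel)"
    proof (intro nn_integral_mono)
      fix x
      let ?p = "indicator {..\<delta>} (h n + x / sqrt (I n)) * prior_ext \<rho> (h n + x / sqrt (I n))"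
      have "l x * exp (- (x\<^sup>2 / 2)) * ?p \<le> A * exp (- (\<delta>\<^sup>2 / 4 * I n)) * ?p"
      proof (cases "h n + x / sqrt (I n) \<le> \<delta>")
        case True
        then have "\<delta> \<le> - (x / sqrt (I n))" using h_bd[of n] by (simp add: \<delta>_def)
        then have "\<delta>\<^sup>2 \<le> (x / sqrt (I n))\<^sup>2" using \<delta> by (subst power2_minus[symmetric], intro power_mono) auto
        then have x2: "\<delta>\<^sup>2 * I n \<le> x\<^sup>2" using I1[of n] by (simp add: power_divide field_simps)
        have "l x * exp (- (x\<^sup>2 / 2)) \<le> (A * exp (1 / 4 * x\<^sup>2)) * exp (- (x\<^sup>2 / 2))"
          using A by (intro mult_right_mono) auto
        also have "\<dots> = A * exp (- (x\<^sup>2 / 4))" by (simp add: mult_exp_exp)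
        also have "\<dots> \<le> A * exp (- (\<delta>\<^sup>2 / 4 * I n))" using x2 A by simp
        finally show ?thesis using prior_ext_nonneg[OF \<rho>] by (intro mult_right_mono) auto
      qed simp
      then have "ennreal (l x * exp (- (x\<^sup>2 / 2)) * ?p) \<le> ennreal (A * exp (- (\<delta>\<^sup>2 / 4 * I n)) * ?p)"
        by (rule ennreal_leI)
      also have "\<dots> = ennreal (A * exp (- (\<delta>\<^sup>2 / 4 * I n))) * ennreal ?p"
        using A by (intro ennreal_mult') auto
      finally show "ennreal (l x * exp (- (x\<^sup>2 / 2)) * ?p) \<le> \<dots>" .
    qed
    also have "\<dots> = ennreal (A * exp (- (\<delta>\<^sup>2 / 4 * I n))) * ?Q"
      by (subst nn_integral_cmult) auto
    also have "?Q = ennreal (sqrt (I n)) * P"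
      unfolding P using sI by (simp add: mult.assoc[symmetric] ennreal_mult'[symmetric])
    also have "ennreal (A * exp (- (\<delta>\<^sup>2 / 4 * I n))) * (ennreal (sqrt (I n)) * P)
       = ennreal (A * sqrt (I n) * exp (- (\<delta>\<^sup>2 / 4 * I n))) * P"
    proof -
      have "ennreal (A * exp (- (\<delta>\<^sup>2 / 4 * I n))) * ennreal (sqrt (I n))
          = ennreal (A * sqrt (I n) * exp (- (\<delta>\<^sup>2 / 4 * I n)))"
        using A sI by (subst ennreal_mult[symmetric]) (auto simp: mult_ac)
      then show ?thesis by (simp add: mult.assoc[symmetric])
    qed
    finally show ?thesis .
  qed
  have "((\<lambda>t. A * sqrt t * exp (- (\<delta>\<^sup>2 / 4 * t))) \<longlongrightarrow> 0) at_top" using \<delta> by real_asymp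
  from tendsto_ennrealI[OF filterlim_compose[OF this I_lim]]
  have "(\<lambda>n. P * ennreal (A * sqrt (I n) * exp (- (\<delta>\<^sup>2 / 4 * I n)))) \<longlonglongrightarrow> P * ennreal 0"
    using fin by (intro ennreal_tendsto_cmult) (auto simp: P_def \<delta>_def)
  then have "(\<lambda>n. ennreal (A * sqrt (I n) * exp (- (\<delta>\<^sup>2 / 4 * I n))) * P) \<longlonglongrightarrow> 0"
    by (simp add: mult.commute)
  with le show ?thesis unfolding \<delta>_def[symmetric]
    by (rule tendsto_sandwich[OF _ _ tendsto_const, rotated 1, OF always_eventually[OF allI]]) auto
qed

lemma rescaled_risk_0_tendsto:
  assumes fin: "(\<integral>\<^sup>+\<theta>. ennreal (indicator {..h0 / 4} \<theta> * prior_ext \<rho> \<theta>) \<partial>lborel) < \<infinity>"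
  shows "(\<lambda>n. rescaled_risk l \<rho> (I n) (h n) 0)
         \<longlonglongrightarrow> (\<integral>\<^sup>+x. ennreal (l x * exp (- (x\<^sup>2 / 2)) * \<rho> h0) \<partial>lborel)"
proof -
  note [measurable] = loss_measurable prior_ext_measurable[OF \<rho>]
  have "rescaled_risk l \<rho> (I n) (h n) 0 =
     (\<integral>\<^sup>+x. ennreal (l x * exp (- (x\<^sup>2 / 2)) *
            (indicator {h0 / 4<..} (h n + x / sqrt (I n)) * prior_ext \<rho> (h n + x / sqrt (I n)))) \<partial>lborel)
   + (\<integral>\<^sup>+x. ennreal (l x * exp (- (x\<^sup>2 / 2)) *
            (indicator {..h0 / 4} (h n + x / sqrt (I n)) * prior_ext \<rho> (h n + x / sqrt (I n)))) \<partial>lborel)" for n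
    unfolding rescaled_risk_def
    by (subst nn_integral_add[symmetric])
       (auto simp: indicator_def intro!: nn_integral_cong)
  then show ?thesis
    using tendsto_add[OF rescaled_risk_bulk_tendsto rescaled_risk_near_0_tendsto[OF fin], of "h0 / 4"] h0
    by simp
qed

text \<open>A bound uniform over all \<open>r\<close> away from \<open>0\<close>, which makes it unnecessary to know beforehand that
  the rescaled minimisers stay bounded.  The weight \<open>exp (- x\<^sup>2 / 2)\<close> restricted to a symmetric window
  is still unimodal, so Anderson's inequality reduces every such \<open>r\<close> to \<open>\<epsilon>\<close>.\<close>

lemma rescaled_risk_lower_bound:
  assumes t: "0 \<le> t" "t < \<rho> h0" and \<epsilon>: "0 \<le> \<epsilon>"
  shows "\<forall>\<^sub>F n in sequentially. \<forall>r. \<epsilon> \<le> \<bar>r\<bar> \<longrightarrow>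
    ennreal t * (\<integral>\<^sup>+x. ennreal (l (x - \<epsilon>) * (exp (- (x\<^sup>2 / 2)) * indicator {-m..m} x)) \<partial>lborel)
      \<le> rescaled_risk l \<rho> (I n) (h n) r"
proof -
  note [measurable] = loss_measurable prior_ext_measurable[OF \<rho>]
  let ?\<phi> = "\<lambda>x::real. exp (- (x\<^sup>2 / 2)) * indicator {-m..m} x :: real"
  have \<phi>_mono: "?\<phi> y \<le> ?\<phi> x" if "\<bar>x\<bar> \<le> \<bar>y\<bar>" for x y
  proof -
    have "x\<^sup>2 \<le> y\<^sup>2" using that by (simp add: abs_le_square_iff)
    then show ?thesis using that by (auto simp: indicator_def)
  qed
  have "\<forall>\<^sub>F y in nhds h0. t < prior_ext \<rho> y"
    using prior_ext_tendsto[OF \<rho> filterlim_ident h0] t(2) by (rule order_tendstoD)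
  then obtain d where d: "0 < d" "\<And>y. dist y h0 < d \<Longrightarrow> t < prior_ext \<rho> y"
    by (auto simp: eventually_nhds_metric)
  have "\<forall>\<^sub>F n in sequentially. dist (h n) h0 < d / 4"
    using h_lim d by (intro tendstoD) auto
  moreover have "\<forall>\<^sub>F n in sequentially. dist (h n + m / sqrt (I n)) h0 < d / 4"
    using local_point_tendsto d by (intro tendstoD) auto
  ultimately show ?thesis
  proof eventually_elim
    case (elim n)
    have sI: "sqrt (I n) > 0" using I1[of n] by simp
    have m': "\<bar>m\<bar> / sqrt (I n) < d / 2"
    proof -
      have "\<bar>m / sqrt (I n)\<bar> < d / 2" using elim unfolding dist_real_def by linarith
      then show ?thesis using sI by (simp add: abs_divide)
    qed
    show ?case
    proof (intro allI impI)
      fix r assume r: "\<epsilon> \<le> \<bar>r\<bar>"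
      have "ennreal t * (\<integral>\<^sup>+x. ennreal (l (x - \<epsilon>) * ?\<phi> x) \<partial>lborel)
          \<le> ennreal t * (\<integral>\<^sup>+x. ennreal (l (x - r) * ?\<phi> x) \<partial>lborel)"
        using r \<epsilon> loss_nonneg
        by (intro mult_left_mono bowl_shift_integral_mono)
           (auto intro: loss_mono_abs[OF loss_in_class] \<phi>_mono)
      also have "\<dots> = (\<integral>\<^sup>+x. ennreal t * ennreal (l (x - r) * ?\<phi> x) \<partial>lborel)"
        by (rule nn_integral_cmult[symmetric]) measurable
      also have "\<dots> \<le> rescaled_risk l \<rho> (I n) (h n) r"
        unfolding rescaled_risk_def
      proof (rule nn_integral_mono)
        fix x
        let ?y = "h n + x / sqrt (I n)"
        have "t * (l (x - r) * ?\<phi> x) \<le> l (x - r) * exp (- (x\<^sup>2 / 2)) * prior_ext \<rho> ?y"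
        proof (cases "x \<in> {-m..m}")
          case True
          then have "\<bar>x\<bar> / sqrt (I n) \<le> \<bar>m\<bar> / sqrt (I n)"
            using sI by (intro divide_right_mono) auto
          then have "\<bar>x / sqrt (I n)\<bar> < d / 2"
            using m' sI by (simp only: abs_divide abs_of_pos)
          then have "dist ?y h0 < d" using elim(1) unfolding dist_real_def by linarith
          then have "t \<le> prior_ext \<rho> ?y" by (rule d(2)[THEN less_imp_le])
          then have "t * (l (x - r) * exp (- (x\<^sup>2 / 2)))
              \<le> prior_ext \<rho> ?y * (l (x - r) * exp (- (x\<^sup>2 / 2)))"
            by (rule mult_right_mono) (simp add: loss_nonneg)
          then show ?thesis using True by (simp add: mult_ac)
        next
          case False
          then have "t * (l (x - r) * ?\<phi> x) = 0" by simp
          also have "0 \<le> l (x - r) * exp (- (x\<^sup>2 / 2)) * prior_ext \<rho> ?y"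
            by (simp add: loss_nonneg prior_ext_nonneg[OF \<rho>])
          finally show ?thesis .
        qed
        then show "ennreal t * ennreal (l (x - r) * ?\<phi> x)
            \<le> ennreal (l (x - r) * exp (- (x\<^sup>2 / 2)) * prior_ext \<rho> ?y)"
          using t(1) by (subst ennreal_mult'[symmetric]) (auto intro: ennreal_leI)
      qed
      finally show "ennreal t * (\<integral>\<^sup>+x. ennreal (l (x - \<epsilon>) * ?\<phi> x) \<partial>lborel)
          \<le> rescaled_risk l \<rho> (I n) (h n) r" .
    qed
  qed
qed

end

section \<open>Bayes estimates lie close to the maximum likelihood estimate\<close>

text \<open>If the bound failed for arbitrarily large \<open>I\<close>, compactness of \<open>K\<close> would give a sequence with
  \<open>h\<close> tending to some \<open>h0 > 0\<close> along which minimisers stay at rescaled distance more than \<open>\<epsilon>\<close>;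
  their risks would eventually exceed the risk at the maximum likelihood estimate itself.\<close>

lemma bayes_estimate_near_mle:
  assumes \<rho>: "\<rho> \<in> prior_class_e2" and l: "l \<in> loss_class_e2"
    and strict_min: "strict_min_on
        (\<lambda>r. \<integral>\<^sup>+x. ennreal (l (x + r) * exp (- (x\<^sup>2 / 2))) \<partial>lborel) UNIV 0"
    and K: "compact K" "K \<subseteq> {0<..}" and \<epsilon>: "0 < \<epsilon>"
  obtains I0 where "\<And>I h. I0 \<le> I \<Longrightarrow> h \<in> K \<Longrightarrow> posterior_exists \<rho> I h \<Longrightarrow> bayes_well_defined l \<rho> I h \<Longrightarrow>
    sqrt I * \<bar>bayes_estimate l \<rho> I h - h\<bar> \<le> \<epsilon>"
proof (rule ccontr)
  assume "\<not> thesis"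
  then have "\<exists>I h. real (Suc n) \<le> I \<and> h \<in> K \<and> posterior_exists \<rho> I h \<and> bayes_well_defined l \<rho> I h \<and>
      \<not> sqrt I * \<bar>bayes_estimate l \<rho> I h - h\<bar> \<le> \<epsilon>" for n :: nat
    using that[of "real (Suc n)"] by blast
  then obtain I h where Ih: "\<And>n. real (Suc n) \<le> I n" "\<And>n. h n \<in> K"
      "\<And>n. posterior_exists \<rho> (I n) (h n)" "\<And>n. bayes_well_defined l \<rho> (I n) (h n)"
      "\<And>n. \<epsilon> < sqrt (I n) * \<bar>bayes_estimate l \<rho> (I n) (h n) - h n\<bar>"
    unfolding not_le by metis
  obtain h0 s where h0: "h0 \<in> K" and s: "strict_mono s" and hs: "(h \<circ> s) \<longlonglongrightarrow> h0"
    using K(1) Ih(2) unfolding compact_eq_seq_compact_metric seq_compact_def by metis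
  have h0_pos: "0 < h0" using K h0 by auto
  have "\<forall>\<^sub>F n in sequentially. h0 / 2 < (h \<circ> s) n" "\<forall>\<^sub>F n in sequentially. (h \<circ> s) n < 2 * h0"
    using h0_pos by (intro order_tendstoD[OF hs]; simp)+
  then have "\<forall>\<^sub>F n in sequentially. h (s n) \<in> {h0 / 2..2 * h0}"
    by eventually_elim auto
  then obtain N where N: "\<And>n. N \<le> n \<Longrightarrow> h (s n) \<in> {h0 / 2..2 * h0}"
    by (auto simp: eventually_sequentially)
  define J k where "J n = I (s (n + N))" and "k n = h (s (n + N))" for n
  have k_bd: "k n \<in> {h0 / 2..2 * h0}" for n unfolding k_def by (rule N) simp
  have k_lim: "k \<longlonglongrightarrow> h0"
    using LIMSEQ_ignore_initial_segment[OF hs, of N] by (simp add: k_def[abs_def])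
  have J_ge: "real (Suc n) \<le> J n" for n
  proof -
    have "n \<le> s (n + N)" using seq_suble[OF s, of "n + N"] by simp
    then show ?thesis using Ih(1)[of "s (n + N)"] by (simp add: J_def)
  qed
  have J1: "1 \<le> J n" for n using J_ge[of n] by simp
  have J_lim: "filterlim J at_top sequentially"
    by (rule filterlim_at_top_mono[OF filterlim_compose[OF filterlim_real_sequentially filterlim_Suc]])
       (use J_ge in simp)
  have "l \<in> loss_class" and l_meas[measurable]: "l \<in> borel_measurable borel" and l_nonneg: "\<And>x. 0 \<le> l x"
    using l by (auto simp: loss_class_e2_def loss_class_def)

  define L where "L r = (\<integral>\<^sup>+x. ennreal (l (x - r) * exp (- (x\<^sup>2 / 2))) \<partial>lborel)" for r
  define \<Lambda> where "\<Lambda> m = (\<integral>\<^sup>+x. ennreal (l (x - \<epsilon>) * (exp (- (x\<^sup>2 / 2)) * indicator {-m..m} x)) \<partial>lborel)" for m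
  have "L 0 < L \<epsilon>"
    using strict_min \<epsilon> unfolding strict_min_on_def L_def
    by (auto dest!: spec[of _ "- \<epsilon>"])
  obtain A where A: "0 < A" "\<And>x. l x \<le> A * exp (1 / 4 * x\<^sup>2)"
    using loss_le_exp_square[OF l, of "1 / 4"] by auto
  have "L 0 \<le> (\<integral>\<^sup>+x. ennreal (A * exp (- (1 / 4 * x\<^sup>2))) \<partial>lborel)"
    unfolding L_def
  proof (intro nn_integral_mono ennreal_leI)
    fix x
    have "l x * exp (- (x\<^sup>2 / 2)) \<le> (A * exp (1 / 4 * x\<^sup>2)) * exp (- (x\<^sup>2 / 2))"
      using A by (intro mult_right_mono) auto
    also have "\<dots> = A * exp (- (1 / 4 * x\<^sup>2))" by (simp add: mult_exp_exp)
    finally show "l (x - 0) * exp (- (x\<^sup>2 / 2)) \<le> A * exp (- (1 / 4 * x\<^sup>2))" by simp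
  qed
  also have "\<dots> < \<infinity>" by (rule nn_integral_exp_square_finite) simp
  finally obtain a where a: "0 \<le> a" "L 0 = ennreal a" by (cases "L 0") auto
  have "(\<lambda>m. \<Lambda> (real m)) \<longlonglongrightarrow> L \<epsilon>"
    unfolding \<Lambda>_def L_def
  proof (rule nn_integral_LIMSEQ)
    show "incseq (\<lambda>m x. ennreal (l (x - \<epsilon>) * (exp (- (x\<^sup>2 / 2)) * indicator {-real m..real m} x)))"
      using l_nonneg by (auto simp: incseq_def le_fun_def indicator_def intro!: ennreal_leI)
    show "(\<lambda>m. ennreal (l (x - \<epsilon>) * (exp (- (x\<^sup>2 / 2)) * indicator {-real m..real m} x)))
        \<longlonglongrightarrow> ennreal (l (x - \<epsilon>) * exp (- (x\<^sup>2 / 2)))" for x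
    proof (rule tendsto_eventually)
      obtain m0 :: nat where "\<bar>x\<bar> \<le> real m0" using real_arch_simple by blast
      then show "\<forall>\<^sub>F m in sequentially. ennreal (l (x - \<epsilon>) * (exp (- (x\<^sup>2 / 2)) * indicator {-real m..real m} x))
          = ennreal (l (x - \<epsilon>) * exp (- (x\<^sup>2 / 2)))"
        by (intro eventually_sequentiallyI[of m0]) (auto simp: indicator_def abs_le_iff)
    qed
  qed measurable
  \<comment> \<open>A window so large that truncation preserves the strict inequality.\<close>
  from order_tendstoD(1)[OF this \<open>L 0 < L \<epsilon>\<close>] obtain m where m: "L 0 < \<Lambda> (real m)"
    by (auto simp: eventually_sequentially)
  then obtain z where z: "L 0 < z" "z < \<Lambda> (real m)" using dense by blast
  then obtain b where b: "0 \<le> b" "z = ennreal b" by (cases z) auto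
  have ab: "a < b" using z(1) a b by (simp add: ennreal_less_iff)

  have \<rho>0: "0 < \<rho> h0" using \<rho> h0_pos by (auto simp: prior_class_e2_def)
  \<comment> \<open>Since \<open>a < b\<close>, some \<open>t < \<rho> h0\<close> still satisfies \<open>\<rho> h0 * a < t * b\<close>.\<close>
  define t where "t = \<rho> h0 * ((a + b) / (2 * b))"
  have t: "0 \<le> t" "t < \<rho> h0" "\<rho> h0 * a < t * b"
    using \<rho>0 ab a(1) by (auto simp: t_def field_simps)
  \<comment> \<open>Integrability of the prior near \<open>0\<close> does not involve the data, so any index will do.\<close>
  have fin: "(\<integral>\<^sup>+\<theta>. ennreal (indicator {..h0 / 4} \<theta> * prior_ext \<rho> \<theta>) \<partial>lborel) < \<infinity>"
    using Ih(3)[of 0] Ih(1)[of 0] by (intro posterior_exists_prior_integrable_near_0[OF \<rho>]) auto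
  have "(\<integral>\<^sup>+x. ennreal (l x * exp (- (x\<^sup>2 / 2)) * \<rho> h0) \<partial>lborel) = L 0 * ennreal (\<rho> h0)"
    unfolding L_def using \<rho>0 l_nonneg
    by (subst nn_integral_multc[symmetric]) (auto simp: ennreal_mult'[symmetric] ennreal_mult''[symmetric])
  also have "\<dots> = ennreal (\<rho> h0 * a)" using a \<rho>0 by (simp add: ennreal_mult mult.commute)
  finally have lim: "(\<lambda>n. rescaled_risk l \<rho> (J n) (k n) 0) \<longlonglongrightarrow> ennreal (\<rho> h0 * a)"
    using rescaled_risk_0_tendsto[OF \<rho> l J_lim J1 k_lim h0_pos k_bd fin] by simp
  have "ennreal (\<rho> h0 * a) < ennreal (t * b)" using t(3) \<rho>0 a by (simp add: ennreal_less_iff)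
  with lim have "\<forall>\<^sub>F n in sequentially. rescaled_risk l \<rho> (J n) (k n) 0 < ennreal (t * b)"
    by (rule order_tendstoD)
  moreover have "\<forall>\<^sub>F n in sequentially. \<forall>r. \<epsilon> \<le> \<bar>r\<bar> \<longrightarrow>
      ennreal t * \<Lambda> (real m) \<le> rescaled_risk l \<rho> (J n) (k n) r"
    unfolding \<Lambda>_def using \<epsilon>
    by (intro rescaled_risk_lower_bound[OF \<rho> l J_lim J1 k_lim h0_pos k_bd t(1,2)]) simp
  ultimately have "\<forall>\<^sub>F n in sequentially. False"
  proof eventually_elim
    case (elim n)
    let ?r = "sqrt (J n) * (bayes_estimate l \<rho> (J n) (k n) - k n)"
    have "\<epsilon> \<le> \<bar>?r\<bar>" using Ih(5)[of "s (n + N)"] J1[of n] by (simp add: J_def k_def abs_mult)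
    then have "ennreal t * \<Lambda> (real m) \<le> rescaled_risk l \<rho> (J n) (k n) ?r" using elim(2) by blast
    also have "\<dots> \<le> rescaled_risk l \<rho> (J n) (k n) 0"
      using J1[of n] k_bd[of n] h0_pos Ih(3,4)
      by (intro rescaled_risk_bayes_le[OF \<rho> \<open>l \<in> loss_class\<close>]) (auto simp: J_def k_def)
    also have "\<dots> < ennreal (t * b)" by (rule elim(1))
    also have "\<dots> = ennreal t * ennreal b" using t b by (simp add: ennreal_mult)
    also have "\<dots> \<le> ennreal t * \<Lambda> (real m)" using z b by (intro mult_left_mono) auto
    finally show False by simp
  qed
  then show False by simp
qed

section \<open>Moments of normal variables\<close>

text \<open>Exponential tilting translates a normal density; moments of \<open>exp (c * X)\<close> and \<open>X * exp (c * X)\<close>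
  thereby reduce to moments of a shifted normal law.\<close>

lemma normal_density_exp_tilt:
  assumes "0 < s"
  shows "normal_density 0 s x * exp (c * x) = exp (c\<^sup>2 * s\<^sup>2 / 2) * normal_density (c * s\<^sup>2) s x"
proof -
  have "- (x\<^sup>2 / (2 * s\<^sup>2)) + c * x = c\<^sup>2 * s\<^sup>2 / 2 + - ((x - c * s\<^sup>2)\<^sup>2 / (2 * s\<^sup>2))"
    using assms by (simp add: field_simps power2_eq_square)
  then show ?thesis by (simp add: normal_density_def mult_exp_exp)
qed

lemma distributed_has_expectation:
  fixes f g :: "real \<Rightarrow> real"
  assumes "distributed M lborel X (\<lambda>x. ennreal (f x))" "g \<in> borel_measurable borel" "\<And>x. 0 \<le> f x"
    and "has_bochner_integral lborel (\<lambda>x. f x * g x) v"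
  shows "has_bochner_integral M (\<lambda>\<omega>. g (X \<omega>)) v"
  using assms distributed_integrable[OF assms(1), of g] distributed_integral[OF assms(1), of g]
  by (simp add: has_bochner_integral_iff)

context
  fixes M :: "'a measure" and X :: "'a \<Rightarrow> real" and s :: real
  assumes X: "distributed M lborel X (normal_density 0 s)" and s: "0 < s"
begin

lemma normal_exp_expectation:
  "has_bochner_integral M (\<lambda>\<omega>. exp (c * X \<omega>)) (exp (c\<^sup>2 * s\<^sup>2 / 2))"
proof (rule distributed_has_expectation[OF X])
  have "has_bochner_integral lborel (normal_density (c * s\<^sup>2) s) 1"
    using s by (simp add: has_bochner_integral_iff)
  from has_bochner_integral_mult_right[OF this, of "exp (c\<^sup>2 * s\<^sup>2 / 2)"]
  show "has_bochner_integral lborel (\<lambda>x. normal_density 0 s x * exp (c * x)) (exp (c\<^sup>2 * s\<^sup>2 / 2))"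
    by (simp add: normal_density_exp_tilt[OF s])
qed auto

lemma normal_mult_exp_expectation:
  "has_bochner_integral M (\<lambda>\<omega>. X \<omega> * exp (c * X \<omega>)) (c * s\<^sup>2 * exp (c\<^sup>2 * s\<^sup>2 / 2))"
proof (rule distributed_has_expectation[OF X])
  have eq: "(\<lambda>x. normal_density 0 s x * (x * exp (c * x)))
      = (\<lambda>x. exp (c\<^sup>2 * s\<^sup>2 / 2) * (normal_density (c * s\<^sup>2) s x * x))"
  proof
    fix x
    have "normal_density 0 s x * (x * exp (c * x)) = (normal_density 0 s x * exp (c * x)) * x"
      by simp
    then show "normal_density 0 s x * (x * exp (c * x))
        = exp (c\<^sup>2 * s\<^sup>2 / 2) * (normal_density (c * s\<^sup>2) s x * x)"
      by (simp add: normal_density_exp_tilt[OF s])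
  qed
  show "has_bochner_integral lborel (\<lambda>x. normal_density 0 s x * (x * exp (c * x)))
      (c * s\<^sup>2 * exp (c\<^sup>2 * s\<^sup>2 / 2))"
    unfolding eq mult.commute[of "c * s\<^sup>2"]
    by (rule has_bochner_integral_mult_right[OF normal_moment_nz_1[OF s]])
qed auto

lemma normal_expectation: "has_bochner_integral M X 0"
  using normal_mult_exp_expectation[of 0] by simp

lemma normal_square_expectation: "has_bochner_integral M (\<lambda>\<omega>. (X \<omega>)\<^sup>2) (s\<^sup>2)"
  using normal_moment_even[OF s, of 0 1] s
  by (intro distributed_has_expectation[OF X]) (auto simp: fact_numeral)

lemma normal_fourth_expectation: "has_bochner_integral M (\<lambda>\<omega>. (X \<omega>) ^ 4) (3 * s ^ 4)"
  using normal_moment_even[OF s, of 0 2] s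
  by (intro distributed_has_expectation[OF X]) (auto simp: fact_numeral power_divide field_simps)

end

text \<open>\<open>X\<close> plays the role of a Brownian increment over a step of length \<open>s\<^sup>2\<close>, and \<open>Y\<close> is what remains of the
  relative increment of the geometric Brownian motion after its mean and its linear part are removed.
  With \<open>\<alpha>\<close> proportional to \<open>s\<^sup>2\<close> the terms of first order in \<open>s\<^sup>2\<close> cancel in the second moment, which is
  what makes the residuals negligible in sum.\<close>

lemma (in prob_space) geometric_increment_residual:
  fixes b \<alpha> s :: real
  assumes X: "distributed M lborel X (normal_density 0 s)" and s: "0 < s"
  defines "Y \<equiv> \<lambda>\<omega>. exp (b * X \<omega> - (\<alpha> + b\<^sup>2 * s\<^sup>2 / 2)) - exp (- \<alpha>) - b * X \<omega>"
  shows "has_bochner_integral M Y 0"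
    and "has_bochner_integral M (\<lambda>\<omega>. (Y \<omega>)\<^sup>2)
      (exp (- \<alpha>) ^ 2 * (exp (b\<^sup>2 * s\<^sup>2) - 1) + b\<^sup>2 * s\<^sup>2 * (1 - 2 * exp (- \<alpha>)))"
proof -
  define c A where "c = exp (- (\<alpha> + b\<^sup>2 * s\<^sup>2 / 2))" and "A = exp (- \<alpha>)"
  have Y: "Y \<omega> = c * exp (b * X \<omega>) - A - b * X \<omega>" for \<omega>
    by (simp add: Y_def c_def A_def mult_exp_exp)
  have c1: "c * exp (b\<^sup>2 * s\<^sup>2 / 2) = A"
    by (simp add: c_def A_def mult_exp_exp)
  have c2: "c\<^sup>2 * exp ((2 * b)\<^sup>2 * s\<^sup>2 / 2) = A\<^sup>2 * exp (b\<^sup>2 * s\<^sup>2)"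
    by (simp add: c_def A_def mult_exp_exp power2_eq_square algebra_simps)
  have const: "has_bochner_integral M (\<lambda>_. v) v" for v :: real
    by (simp add: has_bochner_integral_iff prob_space)
  have "has_bochner_integral M (\<lambda>\<omega>. c * exp (b * X \<omega>) - A - b * X \<omega>)
      (c * exp (b\<^sup>2 * s\<^sup>2 / 2) - A - b * 0)"
    by (intro has_bochner_integral_diff has_bochner_integral_mult_right const
        normal_exp_expectation[OF X s] normal_expectation[OF X s])
  then show "has_bochner_integral M Y 0" by (simp add: Y[abs_def] c1)
  have "has_bochner_integral M (\<lambda>\<omega>. c\<^sup>2 * exp ((2 * b) * X \<omega>) + A\<^sup>2 + b\<^sup>2 * (X \<omega>)\<^sup>2
        - (2 * A * c) * exp (b * X \<omega>) - (2 * b * c) * (X \<omega> * exp (b * X \<omega>)) + (2 * A * b) * X \<omega>)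
      (c\<^sup>2 * exp ((2 * b)\<^sup>2 * s\<^sup>2 / 2) + A\<^sup>2 + b\<^sup>2 * s\<^sup>2
        - (2 * A * c) * exp (b\<^sup>2 * s\<^sup>2 / 2) - (2 * b * c) * (b * s\<^sup>2 * exp (b\<^sup>2 * s\<^sup>2 / 2)) + (2 * A * b) * 0)"
    by (intro has_bochner_integral_diff has_bochner_integral_add has_bochner_integral_mult_right const
        normal_exp_expectation[OF X s] normal_expectation[OF X s]
        normal_mult_exp_expectation[OF X s] normal_square_expectation[OF X s])
  also have "(\<lambda>\<omega>. c\<^sup>2 * exp ((2 * b) * X \<omega>) + A\<^sup>2 + b\<^sup>2 * (X \<omega>)\<^sup>2
        - (2 * A * c) * exp (b * X \<omega>) - (2 * b * c) * (X \<omega> * exp (b * X \<omega>)) + (2 * A * b) * X \<omega>)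
      = (\<lambda>\<omega>. (Y \<omega>)\<^sup>2)"
  proof
    fix \<omega>
    have "exp ((2 * b) * X \<omega>) = exp (b * X \<omega>) * exp (b * X \<omega>)"
      by (simp add: mult_exp_exp)
    then show "c\<^sup>2 * exp ((2 * b) * X \<omega>) + A\<^sup>2 + b\<^sup>2 * (X \<omega>)\<^sup>2
        - (2 * A * c) * exp (b * X \<omega>) - (2 * b * c) * (X \<omega> * exp (b * X \<omega>)) + (2 * A * b) * X \<omega> = (Y \<omega>)\<^sup>2"
      unfolding Y by (simp only:) (simp add: power2_eq_square algebra_simps)
  qed
  also have "c\<^sup>2 * exp ((2 * b)\<^sup>2 * s\<^sup>2 / 2) + A\<^sup>2 + b\<^sup>2 * s\<^sup>2
        - (2 * A * c) * exp (b\<^sup>2 * s\<^sup>2 / 2) - (2 * b * c) * (b * s\<^sup>2 * exp (b\<^sup>2 * s\<^sup>2 / 2)) + (2 * A * b) * 0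
      = A\<^sup>2 * exp (b\<^sup>2 * s\<^sup>2) + A\<^sup>2 + b\<^sup>2 * s\<^sup>2 - 2 * A * (c * exp (b\<^sup>2 * s\<^sup>2 / 2))
        - 2 * b\<^sup>2 * s\<^sup>2 * (c * exp (b\<^sup>2 * s\<^sup>2 / 2))"
    unfolding c2 by (simp add: power2_eq_square)
  also have "\<dots> = A\<^sup>2 * (exp (b\<^sup>2 * s\<^sup>2) - 1) + b\<^sup>2 * s\<^sup>2 * (1 - 2 * A)"
    unfolding c1 by (simp add: power2_eq_square algebra_simps)
  finally show "has_bochner_integral M (\<lambda>\<omega>. (Y \<omega>)\<^sup>2)
      (exp (- \<alpha>) ^ 2 * (exp (b\<^sup>2 * s\<^sup>2) - 1) + b\<^sup>2 * s\<^sup>2 * (1 - 2 * exp (- \<alpha>)))"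
    by (simp add: A_def)
qed

section \<open>The integral of a geometric Brownian motion against its reciprocal\<close>

lemma (in prob_space) sum_orthogonal_second_moment:
  fixes Y :: "nat \<Rightarrow> 'a \<Rightarrow> real"
  assumes int: "\<And>i. i < n \<Longrightarrow> integrable M (Y i)" and sq: "\<And>i. i < n \<Longrightarrow> integrable M (\<lambda>\<omega>. (Y i \<omega>)\<^sup>2)"
    and mean: "\<And>i. i < n \<Longrightarrow> expectation (Y i) = 0"
    and indep: "\<And>i. i < n \<Longrightarrow> indep_var borel (\<lambda>\<omega>. \<Sum>j<i. Y j \<omega>) borel (Y i)"
  shows "has_bochner_integral M (\<lambda>\<omega>. (\<Sum>i<n. Y i \<omega>)\<^sup>2) (\<Sum>i<n. expectation (\<lambda>\<omega>. (Y i \<omega>)\<^sup>2))"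
  using assms
proof (induction n)
  case 0
  then show ?case by (simp add: has_bochner_integral_zero)
next
  case (Suc n)
  let ?S = "\<lambda>\<omega>. \<Sum>i<n. Y i \<omega>"
  have IH: "has_bochner_integral M (\<lambda>\<omega>. (?S \<omega>)\<^sup>2) (\<Sum>i<n. expectation (\<lambda>\<omega>. (Y i \<omega>)\<^sup>2))"
    using Suc by simp
  have iS: "integrable M ?S" using Suc.prems(1) by auto
  have "has_bochner_integral M (\<lambda>\<omega>. ?S \<omega> * Y n \<omega>) 0"
    using indep_var_integrable[OF Suc.prems(4)[of n] iS Suc.prems(1)[of n]]
      indep_var_lebesgue_integral[OF Suc.prems(4)[of n] iS Suc.prems(1)[of n]] Suc.prems(3)[of n]
    by (simp add: has_bochner_integral_iff)
  moreover have "has_bochner_integral M (\<lambda>\<omega>. (Y n \<omega>)\<^sup>2) (expectation (\<lambda>\<omega>. (Y n \<omega>)\<^sup>2))"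
    using Suc.prems(2)[of n] by (simp add: has_bochner_integral_iff)
  ultimately have "has_bochner_integral M (\<lambda>\<omega>. (?S \<omega>)\<^sup>2 + 2 * (?S \<omega> * Y n \<omega>) + (Y n \<omega>)\<^sup>2)
      ((\<Sum>i<n. expectation (\<lambda>\<omega>. (Y i \<omega>)\<^sup>2)) + 2 * 0 + expectation (\<lambda>\<omega>. (Y n \<omega>)\<^sup>2))"
    by (intro has_bochner_integral_add has_bochner_integral_mult_right IH)
  then show ?case by (simp add: power2_sum algebra_simps)
qed

text \<open>Turns independence of a \<open>\<sigma>\<close>-algebra and an increment, the form in which the independence of
  Brownian increments from the past is given, into independence of random variables.\<close>

lemma (in prob_space) indep_var_of_indep_set:
  fixes Z D :: "'a \<Rightarrow> real" and g :: "real \<Rightarrow> real"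
  assumes G: "subalgebra M G" and Z: "Z \<in> borel_measurable G" and D: "D \<in> borel_measurable M"
    and indep: "indep_set (sets G) (sets (vimage_algebra (space M) D borel))"
    and g: "g \<in> borel_measurable borel"
  shows "indep_var borel Z borel (\<lambda>\<omega>. g (D \<omega>))"
proof -
  have spG: "space G = space M" "sets G \<subseteq> sets M" using G by (auto simp: subalgebra_def)
  have ZM: "Z \<in> borel_measurable M" using measurable_from_subalg[OF G Z] .
  have 1: "sigma_sets (space M) {Z -` A \<inter> space M |A. A \<in> sets borel} \<subseteq> sets G"
    unfolding spG(1)[symmetric]
    by (intro sets.sigma_sets_subset) (auto intro: measurable_sets[OF Z])
  have 2: "sigma_sets (space M) {D -` A \<inter> space M |A. A \<in> sets borel}
      = sets (vimage_algebra (space M) D borel)"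
    by (simp add: sets_vimage_algebra)
  have "indep_var borel Z borel D"
    unfolding indep_var_eq 2 using 1 ZM D indep indep_setD[OF indep] indep_setD_ev2[OF indep] spG
    by (auto intro!: indep_setI)
  from indep_var_compose[OF this measurable_ident g] show ?thesis by (simp add: comp_def)
qed

text \<open>With \<open>h = T / n\<close> the sum of \<open>n\<close> equal terms is \<open>T * (f h / h)\<close>, a difference quotient at \<open>0\<close>.\<close>

lemma uniform_partition_sum_tendsto:
  fixes f :: "real \<Rightarrow> real"
  assumes f: "(f has_real_derivative D) (at 0)" "f 0 = 0" and T: "0 < T"
  shows "(\<lambda>n. real (Suc n) * f (T / real (Suc n))) \<longlonglongrightarrow> T * D"
proof -
  have "(\<lambda>n. T / real (Suc n)) \<longlonglongrightarrow> 0" by (rule LIMSEQ_Suc[OF lim_const_over_n])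
  then have "filterlim (\<lambda>n. T / real (Suc n)) (at 0) sequentially"
    using T by (auto simp: filterlim_at)
  moreover have "((\<lambda>h. f h / h) \<longlongrightarrow> D) (at 0)" using f by (simp add: DERIV_def)
  ultimately have "(\<lambda>n. f (T / real (Suc n)) / (T / real (Suc n))) \<longlonglongrightarrow> D"
    by (rule filterlim_compose[rotated])
  from tendsto_mult_left[OF this, of T] show ?thesis
    by (rule Lim_transform_eventually) (use T in \<open>auto simp: field_simps\<close>)
qed

lemma (in finite_measure) AE_eq_if_close_in_measure:
  fixes X Y :: "'a \<Rightarrow> real"
  assumes [measurable]: "X \<in> borel_measurable M" "Y \<in> borel_measurable M"
    and close: "\<And>\<epsilon>. 0 < \<epsilon> \<Longrightarrow> measure M {\<omega> \<in> space M. 2 * \<epsilon> < \<bar>X \<omega> - Y \<omega>\<bar>} \<le> 2 * \<epsilon>"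
  shows "AE \<omega> in M. X \<omega> = Y \<omega>"
proof -
  have null: "AE \<omega> in M. \<not> \<delta> < \<bar>X \<omega> - Y \<omega>\<bar>" if \<delta>: "0 < \<delta>" for \<delta>
  proof -
    let ?B = "\<lambda>\<delta>. {\<omega> \<in> space M. \<delta> < \<bar>X \<omega> - Y \<omega>\<bar>}"
    have "measure M (?B \<delta>) \<le> 0 + \<epsilon>" if "0 < \<epsilon>" for \<epsilon>
    proof -
      define e where "e = min \<epsilon> \<delta> / 2"
      have e: "0 < e" "2 * e \<le> \<epsilon>" "2 * e \<le> \<delta>" using that \<delta> by (auto simp: e_def)
      have "measure M (?B \<delta>) \<le> measure M (?B (2 * e))"
        using e by (intro finite_measure_mono) auto
      then show ?thesis using close[OF e(1)] e(2) by linarith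
    qed
    then have "measure M (?B \<delta>) \<le> 0" by (rule field_le_epsilon)
    then have "emeasure M (?B \<delta>) = 0" by (simp add: emeasure_eq_measure measure_le_0_iff)
    then show ?thesis by (subst AE_iff_measurable[OF _ refl]) auto
  qed
  have "AE \<omega> in M. \<forall>n. \<not> 1 / real (Suc n) < \<bar>X \<omega> - Y \<omega>\<bar>"
    unfolding AE_all_countable by (intro allI null) simp
  then show ?thesis
  proof eventually_elim
    case (elim \<omega>)
    have "\<bar>X \<omega> - Y \<omega>\<bar> \<le> 0"
    proof (rule ccontr)
      assume "\<not> ?thesis"
      then obtain n where "inverse (real (Suc n)) < \<bar>X \<omega> - Y \<omega>\<bar>"
        using reals_Archimedean[of "\<bar>X \<omega> - Y \<omega>\<bar>"] by auto
      then show False using elim by (simp add: inverse_eq_divide)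
    qed
    then show ?case by simp
  qed
qed

text \<open>Ito's formula for \<open>ln u\<close>, by hand.  Along the uniform partition with step \<open>h\<close> the Riemann sum is
  a sum of relative increments \<open>u (\<tau> (i + 1)) / u (\<tau> i) - 1\<close>.  These decompose into a deterministic
  drift, a multiple of the Brownian increment, and orthogonal residuals whose total second moment
  vanishes with \<open>h\<close>.  A limit in probability is unique, so one sequence of partitions suffices to
  identify the integral.\<close>

lemma log_integral_geometric_brownian_motion:
  fixes W :: "real \<Rightarrow> 'a \<Rightarrow> real" and U :: "'a \<Rightarrow> real" and a b T :: real
  assumes basis: "stochastic_basis M F" and bm: "brownian_motion M F W" and T: "0 < T"
    and U: "U \<in> borel_measurable M" and U_nz: "AE \<omega> in M. U \<omega> \<noteq> 0"
    and u_def: "u = (\<lambda>t \<omega>. U \<omega> * exp (- (a + b\<^sup>2 / 2) * t + b * W t \<omega>))"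
    and J: "is_stochastic_integral M T (\<lambda>t \<omega>. 1 / u t \<omega>) u J"
  shows "AE \<omega> in M. J \<omega> = b * (W T \<omega> - W 0 \<omega>) - a * T"
proof -
  interpret stochastic_basis M F by fact
  have WF: "W t \<in> borel_measurable (F t)" if "0 \<le> t" for t
    using bm that by (simp add: brownian_motion_def)
  have WF': "W s \<in> borel_measurable (F t)" if "0 \<le> s" "s \<le> t" for s t
    using measurable_mono[of borel borel "F s" "F t"] WF[of s] increasing[of s t]
      subalgebra[of s] subalgebra[of t] that by (auto simp: subalgebra_def)
  have WM: "W t \<in> borel_measurable M" if "0 \<le> t" for t
    using measurable_from_subalg[OF subalgebra WF] that by blast
  have JM: "J \<in> borel_measurable M" using J by (simp add: is_stochastic_integral_def)
  define h where "h n = T / real (Suc n)" for n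
  define \<tau> where "\<tau> n i = real i * h n" for n i
  have h: "0 < h n" for n using T by (simp add: h_def)
  have \<tau>: "0 \<le> \<tau> n i" "\<tau> n (Suc i) - \<tau> n i = h n" "\<tau> n i < \<tau> n (Suc i)" for n i
    using h[of n] by (auto simp: \<tau>_def algebra_simps)
  have \<tau>_mono: "\<tau> n i \<le> \<tau> n j" if "i \<le> j" for n i j
    using that h[of n] by (simp add: \<tau>_def)
  have part: "is_partition T (Suc n) (\<tau> n)" for n
    using \<tau>(3) by (auto simp: is_partition_def \<tau>_def h_def)
  note [measurable] = U JM WM[OF \<tau>(1)] WM[OF order_refl] WM[OF less_imp_le[OF T]]
  define D where "D n i \<omega> = W (\<tau> n (Suc i)) \<omega> - W (\<tau> n i) \<omega>" for n i \<omega>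
  define g where "g n x = exp (b * x - (a * h n + b\<^sup>2 * (sqrt (h n))\<^sup>2 / 2)) - exp (- (a * h n)) - b * x"
    for n x
  define Y where "Y n i \<omega> = g n (D n i \<omega>)" for n i \<omega>
  \<comment> \<open>The second moment of one residual, as a function of the step; both \<open>v\<close> and its derivative vanish at \<open>0\<close>.\<close>
  define v where "v t = exp (- (a * t)) ^ 2 * (exp (b\<^sup>2 * t) - 1) + b\<^sup>2 * t * (1 - 2 * exp (- (a * t)))"
    for t
  have D_normal: "distributed M lborel (D n i) (normal_density 0 (sqrt (h n)))"
    and D_indep: "indep_set (sets (F (\<tau> n i))) (sets (vimage_algebra (space M) (D n i) borel))" for n i
    using bm \<tau>[of n i] unfolding brownian_motion_def D_def[abs_def] by metis+
  have sh: "0 < sqrt (h n)" for n using h by simp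
  have D_meas[measurable]: "D n i \<in> borel_measurable M" for n i unfolding D_def[abs_def] by measurable
  have g_meas[measurable]: "g n \<in> borel_measurable borel" for n unfolding g_def[abs_def] by measurable
  have Y_meas[measurable]: "Y n i \<in> borel_measurable M" for n i unfolding Y_def[abs_def] by measurable
  have Y_mean: "has_bochner_integral M (Y n i) 0"
    and Y_sq: "has_bochner_integral M (\<lambda>\<omega>. (Y n i \<omega>)\<^sup>2) (v (h n))" for n i
    using geometric_increment_residual[OF D_normal[of n i] sh[of n], where b = b and \<alpha> = "a * h n"] h[of n]
    by (auto simp: Y_def[abs_def] g_def v_def)
  have Y_F: "(\<lambda>\<omega>. \<Sum>j<i. Y n j \<omega>) \<in> borel_measurable (F (\<tau> n i))" for n i
  proof (rule borel_measurable_sum)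
    fix j assume "j \<in> {..<i}"
    then have [measurable]: "W (\<tau> n (Suc j)) \<in> borel_measurable (F (\<tau> n i))" "W (\<tau> n j) \<in> borel_measurable (F (\<tau> n i))"
      by (auto intro!: WF' \<tau>(1) \<tau>_mono)
    show "Y n j \<in> borel_measurable (F (\<tau> n i))" unfolding Y_def[abs_def] D_def by measurable
  qed
  have sum_sq: "has_bochner_integral M (\<lambda>\<omega>. (\<Sum>i<Suc n. Y n i \<omega>)\<^sup>2) (real (Suc n) * v (h n))" for n
  proof -
    have "has_bochner_integral M (\<lambda>\<omega>. (\<Sum>i<Suc n. Y n i \<omega>)\<^sup>2) (\<Sum>i<Suc n. expectation (\<lambda>\<omega>. (Y n i \<omega>)\<^sup>2))"
    proof (rule sum_orthogonal_second_moment)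
      show "indep_var borel (\<lambda>\<omega>. \<Sum>j<i. Y n j \<omega>) borel (Y n i)" for i
        unfolding Y_def[of n i, abs_def]
        by (rule indep_var_of_indep_set[OF subalgebra[OF \<tau>(1)] Y_F D_meas D_indep g_meas])
    qed (use Y_mean Y_sq in \<open>auto simp: has_bochner_integral_iff\<close>)
    then show ?thesis using Y_sq by (simp add: has_bochner_integral_iff del: sum.lessThan_Suc)
  qed
  define K where "K \<omega> = b * (W T \<omega> - W 0 \<omega>) - a * T" for \<omega>
  have [measurable]: "K \<in> borel_measurable M" unfolding K_def[abs_def] by measurable
  \<comment> \<open>The drift contributed by the means of the relative increments, compared with its limit \<open>- a * T\<close>.\<close>
  define c where "c n = real (Suc n) * (exp (- (a * h n)) - 1) + a * T" for n
  define R where "R n \<omega> = (\<Sum>i<Suc n. 1 / u (\<tau> n i) \<omega> * (u (\<tau> n (Suc i)) \<omega> - u (\<tau> n i) \<omega>))" for n \<omega>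
  have [measurable]: "R n \<in> borel_measurable M" for n unfolding R_def[abs_def] u_def by measurable
  have R_eq: "AE \<omega> in M. R n \<omega> - K \<omega> = (\<Sum>i<Suc n. Y n i \<omega>) + c n" for n
    using U_nz
  proof eventually_elim
    case (elim \<omega>)
    have step: "1 / u (\<tau> n i) \<omega> * (u (\<tau> n (Suc i)) \<omega> - u (\<tau> n i) \<omega>)
        = Y n i \<omega> + (exp (- (a * h n)) - 1) + b * (W (\<tau> n (Suc i)) \<omega> - W (\<tau> n i) \<omega>)" for i
    proof -
      have nz: "u (\<tau> n i) \<omega> \<noteq> 0" using elim by (simp add: u_def)
      have "u (\<tau> n (Suc i)) \<omega> / u (\<tau> n i) \<omega> = exp ((- (a + b\<^sup>2 / 2) * \<tau> n (Suc i) + b * W (\<tau> n (Suc i)) \<omega>)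
          - (- (a + b\<^sup>2 / 2) * \<tau> n i + b * W (\<tau> n i) \<omega>))"
        using elim by (simp add: u_def exp_diff)
      also have "(- (a + b\<^sup>2 / 2) * \<tau> n (Suc i) + b * W (\<tau> n (Suc i)) \<omega>)
          - (- (a + b\<^sup>2 / 2) * \<tau> n i + b * W (\<tau> n i) \<omega>)
          = b * D n i \<omega> - (a + b\<^sup>2 / 2) * (\<tau> n (Suc i) - \<tau> n i)"
        by (simp add: D_def field_simps)
      also have "\<dots> = b * D n i \<omega> - (a * h n + b\<^sup>2 * (sqrt (h n))\<^sup>2 / 2)"
        unfolding \<tau>(2) using h[of n] by (simp add: algebra_simps)
      finally have "u (\<tau> n (Suc i)) \<omega> / u (\<tau> n i) \<omega> = Y n i \<omega> + exp (- (a * h n)) + b * D n i \<omega>"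
        by (simp add: Y_def g_def)
      moreover have "1 / u (\<tau> n i) \<omega> * (u (\<tau> n (Suc i)) \<omega> - u (\<tau> n i) \<omega>) = u (\<tau> n (Suc i)) \<omega> / u (\<tau> n i) \<omega> - 1"
        using nz by (simp add: field_simps)
      ultimately show ?thesis by (simp add: D_def)
    qed
    have tele: "(\<Sum>i<Suc n. W (\<tau> n (Suc i)) \<omega> - W (\<tau> n i) \<omega>) = W T \<omega> - W 0 \<omega>"
      using sum_lessThan_telescope[of "\<lambda>i. W (\<tau> n i) \<omega>" "Suc n"] T
      by (simp add: \<tau>_def h_def del: sum.lessThan_Suc)
    show ?case
      unfolding R_def step sum.distrib sum_distrib_left[symmetric] tele K_def c_def by simp
  qed
  have "(\<lambda>n. real (Suc n) * (exp (- (a * h n)) - 1)) \<longlonglongrightarrow> T * (- a)"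
    unfolding h_def
    by (rule uniform_partition_sum_tendsto[where f = "\<lambda>t. exp (- (a * t)) - 1"])
       (use T in \<open>auto intro!: derivative_eq_intros\<close>)
  from tendsto_add[OF this tendsto_const[of "a * T"]]
  have c_lim: "c \<longlonglongrightarrow> 0" by (simp add: c_def[abs_def])
  have v_lim: "(\<lambda>n. real (Suc n) * v (h n)) \<longlonglongrightarrow> T * 0"
    unfolding h_def
    by (rule uniform_partition_sum_tendsto[where f = v])
       (use T in \<open>auto simp: v_def[abs_def] intro!: derivative_eq_intros\<close>)
  have "measure M {\<omega> \<in> space M. 2 * \<epsilon> < \<bar>J \<omega> - K \<omega>\<bar>} \<le> 2 * \<epsilon>" if \<epsilon>: "0 < \<epsilon>" for \<epsilon>
  proof -
    obtain \<delta> where \<delta>: "0 < \<delta>" "\<And>m \<tau>. is_partition T m \<tau> \<Longrightarrow> (\<forall>i<m. \<tau> (Suc i) - \<tau> i < \<delta>) \<Longrightarrow>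
        measure M {\<omega> \<in> space M. \<bar>(\<Sum>i<m. 1 / u (\<tau> i) \<omega> * (u (\<tau> (Suc i)) \<omega> - u (\<tau> i) \<omega>)) - J \<omega>\<bar> > \<epsilon>} < \<epsilon>"
      using J \<epsilon> unfolding is_stochastic_integral_def by blast
    have "h \<longlonglongrightarrow> 0" unfolding h_def[abs_def] by (rule LIMSEQ_Suc[OF lim_const_over_n])
    then have "\<forall>\<^sub>F n in sequentially. h n < \<delta>" using \<delta>(1) by (rule order_tendstoD)
    moreover have "\<forall>\<^sub>F n in sequentially. \<bar>c n\<bar> < \<epsilon> / 2"
      using tendstoD[OF c_lim, of "\<epsilon> / 2"] \<epsilon> by simp
    moreover have "\<forall>\<^sub>F n in sequentially. real (Suc n) * v (h n) < \<epsilon> * (\<epsilon> / 2)\<^sup>2"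
      using v_lim \<epsilon> by (intro order_tendstoD(2)) auto
    ultimately have "\<forall>\<^sub>F n in sequentially. h n < \<delta> \<and> \<bar>c n\<bar> < \<epsilon> / 2 \<and>
        real (Suc n) * v (h n) < \<epsilon> * (\<epsilon> / 2)\<^sup>2"
      by eventually_elim simp
    then obtain n where n: "h n < \<delta>" "\<bar>c n\<bar> < \<epsilon> / 2" "real (Suc n) * v (h n) < \<epsilon> * (\<epsilon> / 2)\<^sup>2"
      by (auto simp: eventually_sequentially)
    have P1: "measure M {\<omega> \<in> space M. \<epsilon> < \<bar>R n \<omega> - J \<omega>\<bar>} \<le> \<epsilon>"
      using \<delta>(2)[OF part[of n]] n(1) \<tau>(2) by (simp add: R_def del: sum.lessThan_Suc)
    have "measure M {\<omega> \<in> space M. \<epsilon> < \<bar>R n \<omega> - K \<omega>\<bar>}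
        \<le> measure M {\<omega> \<in> space M. \<epsilon> / 2 \<le> \<bar>\<Sum>i<Suc n. Y n i \<omega>\<bar>}"
      using R_eq[of n] n(2) by (intro finite_measure_mono_AE) (auto simp del: sum.lessThan_Suc)
    also have "\<dots> \<le> expectation (\<lambda>\<omega>. (\<Sum>i<Suc n. Y n i \<omega>)\<^sup>2) / (\<epsilon> / 2)\<^sup>2"
      using sum_sq[of n] \<epsilon> by (intro second_moment_method) (auto simp: has_bochner_integral_iff simp del: sum.lessThan_Suc)
    also have "expectation (\<lambda>\<omega>. (\<Sum>i<Suc n. Y n i \<omega>)\<^sup>2) = real (Suc n) * v (h n)"
      using sum_sq[of n] by (rule has_bochner_integral_integral_eq)
    also have "real (Suc n) * v (h n) / (\<epsilon> / 2)\<^sup>2 \<le> \<epsilon>"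
      using n(3) \<epsilon> by (simp add: field_simps)
    finally have P2: "measure M {\<omega> \<in> space M. \<epsilon> < \<bar>R n \<omega> - K \<omega>\<bar>} \<le> \<epsilon>" .
    have "measure M {\<omega> \<in> space M. 2 * \<epsilon> < \<bar>J \<omega> - K \<omega>\<bar>}
        \<le> measure M ({\<omega> \<in> space M. \<epsilon> < \<bar>R n \<omega> - J \<omega>\<bar>} \<union> {\<omega> \<in> space M. \<epsilon> < \<bar>R n \<omega> - K \<omega>\<bar>})"
      by (intro finite_measure_mono) auto
    also have "\<dots> \<le> measure M {\<omega> \<in> space M. \<epsilon> < \<bar>R n \<omega> - J \<omega>\<bar>} + measure M {\<omega> \<in> space M. \<epsilon> < \<bar>R n \<omega> - K \<omega>\<bar>}"
      by (rule measure_Un_le) auto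
    finally show ?thesis using P1 P2 by simp
  qed
  from AE_eq_if_close_in_measure[OF _ _ this]
  show ?thesis by (simp add: K_def)
qed

section \<open>The error of the maximum likelihood estimate\<close>

text \<open>Well-posedness gives \<open>\<sigma>\<^sup>2 * q\<^sup>2 \<le> 2 * \<theta>bar * \<mu>\<close>, so the \<open>k\<close>-th summand of the information is at least
  \<open>T * \<mu> k / (2 * \<theta>bar)\<close>, which tends to infinity.\<close>

lemma fisher_info_grows_linearly:
  assumes \<sigma>: "\<sigma> > 0" and T: "T > 0"
    and \<mu>_lim: "filterlim \<mu> at_top sequentially" and q_pos: "\<And>k. k \<ge> 1 \<Longrightarrow> q k > 0"
    and well_posed: "\<exists>\<theta>bar N0 c. \<theta>bar > 0 \<and> N0 \<ge> 1 \<and> c > 0 \<and>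
        (\<forall>k\<ge>N0. 2 * \<theta>bar - \<sigma>\<^sup>2 * (q k)\<^sup>2 / \<mu> k \<ge> c)"
  shows "\<forall>\<^sub>F N in sequentially. real N \<le> fisher_info \<mu> q \<sigma> T N"
proof -
  obtain \<theta>bar N0 c where wp: "\<theta>bar > 0" "N0 \<ge> (1::nat)" "c > 0"
    "\<And>k. k \<ge> N0 \<Longrightarrow> 2 * \<theta>bar - \<sigma>\<^sup>2 * (q k)\<^sup>2 / \<mu> k \<ge> c" using well_posed by auto
  define i where "i k = T / \<sigma>\<^sup>2 * ((\<mu> k)\<^sup>2 / (q k)\<^sup>2)" for k
  have i_nonneg: "0 \<le> i k" for k using T by (simp add: i_def)
  have "\<forall>\<^sub>F k in sequentially. max 1 (4 * \<theta>bar / T) \<le> \<mu> k"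
    using \<mu>_lim unfolding filterlim_at_top by blast
  with eventually_ge_at_top[of N0] have "\<forall>\<^sub>F k in sequentially. 2 \<le> i k"
  proof eventually_elim
    case (elim k)
    have \<mu>: "0 < \<mu> k" "4 * \<theta>bar / T \<le> \<mu> k" using elim by auto
    have q: "0 < q k" using q_pos[of k] elim wp by simp
    have "\<sigma>\<^sup>2 * (q k)\<^sup>2 / \<mu> k \<le> 2 * \<theta>bar" using wp(3) wp(4)[of k] elim by simp
    then have "2 * (\<sigma>\<^sup>2 * (q k)\<^sup>2) \<le> 2 * (2 * \<theta>bar * \<mu> k)" using \<mu> by (simp add: field_simps)
    also have "\<dots> = (4 * \<theta>bar) * \<mu> k" by simp
    also have "\<dots> \<le> (T * \<mu> k) * \<mu> k" using \<mu> T by (intro mult_right_mono) (simp_all add: field_simps)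
    finally show ?case using q \<sigma> by (simp add: i_def field_simps power2_eq_square)
  qed
  then obtain K where K: "\<And>k. K \<le> k \<Longrightarrow> 2 \<le> i k" by (auto simp: eventually_sequentially)
  show ?thesis
  proof (rule eventually_sequentiallyI[of "2 * Suc K"])
    fix N assume N: "2 * Suc K \<le> N"
    have "real N \<le> real (card {Suc K..N}) * 2" using N by simp
    also have "\<dots> = (\<Sum>k=Suc K..N. 2)" by simp
    also have "\<dots> \<le> (\<Sum>k=Suc K..N. i k)" using K by (intro sum_mono) auto
    also have "\<dots> \<le> (\<Sum>k=1..N. i k)" using i_nonneg by (intro sum_mono2) auto
    also have "\<dots> = fisher_info \<mu> q \<sigma> T N" by (simp add: i_def fisher_info_def sum_distrib_left)
    finally show "real N \<le> fisher_info \<mu> q \<sigma> T N" .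
  qed
qed

text \<open>The deviation of the maximum likelihood estimate from the true parameter.  It does not depend on
  that parameter, which is the source of all uniformity in the parameter.\<close>

definition mle_error ::
    "(nat \<Rightarrow> real) \<Rightarrow> (nat \<Rightarrow> real) \<Rightarrow> real \<Rightarrow> real \<Rightarrow> (nat \<Rightarrow> real \<Rightarrow> 'a \<Rightarrow> real) \<Rightarrow> nat \<Rightarrow> 'a \<Rightarrow> real" where
  "mle_error \<mu> q \<sigma> T w N \<omega> =
     - ((\<Sum>k=1..N. \<sigma> * \<mu> k / q k * (w k T \<omega> - w k 0 \<omega>)) / (T * (\<Sum>k=1..N. (\<mu> k)\<^sup>2 / (q k)\<^sup>2)))"

context
  fixes \<mu> q :: "nat \<Rightarrow> real" and \<sigma> T :: real and N :: nat
  assumes \<sigma>: "\<sigma> > 0" and T: "T > 0" and \<mu>_pos: "\<And>k. k \<ge> 1 \<Longrightarrow> \<mu> k > 0"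
    and q_pos: "\<And>k. k \<ge> 1 \<Longrightarrow> q k > 0" and N: "N \<ge> 1"
begin

lemma squared_ratio_sum_pos: "0 < (\<Sum>k=1..N. (\<mu> k)\<^sup>2 / (q k)\<^sup>2)"
proof (rule sum_pos)
  show "0 < (\<mu> k)\<^sup>2 / (q k)\<^sup>2" if "k \<in> {1..N}" for k
    using \<mu>_pos[of k] q_pos[of k] that by simp
qed (use N in auto)

lemma theta_hat_eq_mle_error:
  assumes J: "\<And>k. k \<in> {1..N} \<Longrightarrow> J k \<omega> = \<sigma> * q k * (w k T \<omega> - w k 0 \<omega>) - \<theta>0 * \<mu> k * T"
  shows "theta_hat \<mu> q T J N \<omega> = \<theta>0 + mle_error \<mu> q \<sigma> T w N \<omega>"
proof -
  let ?b = "\<Sum>k=1..N. (\<mu> k)\<^sup>2 / (q k)\<^sup>2" and ?S = "\<Sum>k=1..N. \<sigma> * \<mu> k / q k * (w k T \<omega> - w k 0 \<omega>)"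
  have "(\<Sum>k=1..N. \<mu> k / (q k)\<^sup>2 * J k \<omega>)
      = (\<Sum>k=1..N. \<sigma> * \<mu> k / q k * (w k T \<omega> - w k 0 \<omega>) - \<theta>0 * T * ((\<mu> k)\<^sup>2 / (q k)\<^sup>2))"
  proof (rule sum.cong)
    fix k assume k: "k \<in> {1..N}"
    then have "q k \<noteq> 0" using q_pos[of k] by simp
    then show "\<mu> k / (q k)\<^sup>2 * J k \<omega>
        = \<sigma> * \<mu> k / q k * (w k T \<omega> - w k 0 \<omega>) - \<theta>0 * T * ((\<mu> k)\<^sup>2 / (q k)\<^sup>2)"
      unfolding J[OF k] by (simp add: field_simps power2_eq_square)
  qed simp
  also have "\<dots> = ?S - \<theta>0 * T * ?b" by (simp add: sum_subtractf sum_distrib_left)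
  finally show ?thesis
    using squared_ratio_sum_pos T by (simp add: theta_hat_def mle_error_def field_simps)
qed

lemma mle_error_distribution:
  fixes M :: "'a measure"
  assumes basis: "stochastic_basis M F" and brownian: "independent_brownian_motions M F w {1..}"
  shows "distributed M lborel (mle_error \<mu> q \<sigma> T w N)
    (normal_density 0 (sqrt (1 / fisher_info \<mu> q \<sigma> T N)))"
proof -
  interpret stochastic_basis M F by fact
  let ?b = "\<Sum>k=1..N. (\<mu> k)\<^sup>2 / (q k)\<^sup>2"
  define c where "c k = - (\<sigma> * \<mu> k / q k / (T * ?b))" for k
  define X where "X k \<omega> = w k T \<omega> - w k 0 \<omega>" for k \<omega>
  have b: "0 < ?b" by (rule squared_ratio_sum_pos)
  have c: "c k \<noteq> 0" if "k \<in> {1..N}" for k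
    using \<mu>_pos[of k] q_pos[of k] \<sigma> T b that by (auto simp: c_def)
  have X: "distributed M lborel (X k) (normal_density 0 (sqrt T))" if "k \<in> {1..N}" for k
  proof -
    have "brownian_motion M F (w k)" using brownian that by (auto simp: independent_brownian_motions_def)
    then have "distributed M lborel (\<lambda>\<omega>. w k T \<omega> - w k 0 \<omega>) (normal_density 0 (sqrt (T - 0)))"
      using T unfolding brownian_motion_def by (metis order_refl)
    then show ?thesis by (simp add: X_def[abs_def])
  qed
  have "indep_vars (\<lambda>_. PiM {0..} (\<lambda>_::real. borel)) (\<lambda>k \<omega>. restrict (\<lambda>t. w k t \<omega>) {0..}) {1..}"
    using brownian by (simp add: independent_brownian_motions_def)
  then have w_indep: "indep_vars (\<lambda>_. PiM {0..} (\<lambda>_::real. borel)) (\<lambda>k \<omega>. restrict (\<lambda>t. w k t \<omega>) {0..}) {1..N}"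
    by (rule indep_vars_subset) auto
  have "indep_vars (\<lambda>_. borel) (\<lambda>k \<omega>. c k * (restrict (\<lambda>t. w k t \<omega>) {0..} T - restrict (\<lambda>t. w k t \<omega>) {0..} 0)) {1..N}"
    using T by (intro indep_vars_compose2[OF w_indep, where Y = "\<lambda>k f. c k * (f T - f 0)"]) auto
  then have indep: "indep_vars (\<lambda>_. borel) (\<lambda>k \<omega>. 0 + c k * X k \<omega>) {1..N}"
    using T by (simp add: X_def)
  have "distributed M lborel (\<lambda>\<omega>. \<Sum>k=1..N. 0 + c k * X k \<omega>)
      (normal_density (\<Sum>k=1..N. 0 + c k * 0) (sqrt (\<Sum>k=1..N. (\<bar>c k\<bar> * sqrt T)\<^sup>2)))"
  proof (rule sum_indep_normal[OF _ _ indep])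
    show "distributed M lborel (\<lambda>\<omega>. 0 + c k * X k \<omega>) (normal_density (0 + c k * 0) (\<bar>c k\<bar> * sqrt T))"
      if "k \<in> {1..N}" for k
      using T c[OF that] by (intro normal_density_affine X that) auto
  qed (use N T c in auto)
  also have "(\<lambda>\<omega>. \<Sum>k=1..N. 0 + c k * X k \<omega>) = mle_error \<mu> q \<sigma> T w N"
    by (simp add: fun_eq_iff mle_error_def c_def X_def sum_negf sum_divide_distrib)
  also have "(\<Sum>k=1..N. (\<bar>c k\<bar> * sqrt T)\<^sup>2) = 1 / fisher_info \<mu> q \<sigma> T N"
  proof -
    have "(\<Sum>k=1..N. (\<bar>c k\<bar> * sqrt T)\<^sup>2) = (\<Sum>k=1..N. \<sigma>\<^sup>2 / (T * ?b\<^sup>2) * ((\<mu> k)\<^sup>2 / (q k)\<^sup>2))"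
      using T b by (intro sum.cong) (simp_all add: c_def power_mult_distrib power_divide field_simps power2_eq_square[of T])
    also have "\<dots> = \<sigma>\<^sup>2 / (T * ?b\<^sup>2) * ?b" by (simp add: sum_distrib_left)
    also have "\<dots> = 1 / fisher_info \<mu> q \<sigma> T N"
      using b T \<sigma> by (simp add: fisher_info_def power2_eq_square field_simps)
    finally show ?thesis .
  qed
  finally show ?thesis by simp
qed

text \<open>The fourth moment rather than the variance, so that the bound is summable when the information
  grows linearly.\<close>

lemma mle_error_tail:
  fixes M :: "'a measure"
  assumes basis: "stochastic_basis M F" and brownian: "independent_brownian_motions M F w {1..}"
    and \<delta>: "0 < \<delta>"
  shows "measure M {\<omega> \<in> space M. \<delta> \<le> \<bar>mle_error \<mu> q \<sigma> T w N \<omega>\<bar>}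
    \<le> 3 / (\<delta> ^ 4 * (fisher_info \<mu> q \<sigma> T N)\<^sup>2)"
proof -
  interpret stochastic_basis M F by fact
  let ?I = "fisher_info \<mu> q \<sigma> T N" and ?Z = "mle_error \<mu> q \<sigma> T w N"
  have I: "0 < ?I" using squared_ratio_sum_pos T \<sigma> by (simp add: fisher_info_def)
  have Z4: "has_bochner_integral M (\<lambda>\<omega>. ?Z \<omega> ^ 4) (3 * sqrt (1 / ?I) ^ 4)"
    using I by (intro normal_fourth_expectation mle_error_distribution[OF basis brownian]) auto
  have "sqrt (1 / ?I) ^ 4 = ((sqrt (1 / ?I))\<^sup>2)\<^sup>2" by simp
  then have I4: "sqrt (1 / ?I) ^ 4 = 1 / ?I\<^sup>2" using I by (simp add: power_divide)
  have "{\<omega> \<in> space M. \<delta> \<le> \<bar>?Z \<omega>\<bar>} = {\<omega> \<in> space M. \<delta> ^ 4 \<le> ?Z \<omega> ^ 4}"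
  proof -
    have "\<delta> \<le> \<bar>z\<bar> \<longleftrightarrow> \<delta> ^ 4 \<le> z ^ 4" for z
      using power_mono_iff[of \<delta> "\<bar>z\<bar>" 4] \<delta> by simp
    then show ?thesis by simp
  qed
  then have "measure M {\<omega> \<in> space M. \<delta> \<le> \<bar>?Z \<omega>\<bar>} \<le> expectation (\<lambda>\<omega>. ?Z \<omega> ^ 4) / \<delta> ^ 4"
    using Z4 \<delta> integral_Markov_inequality_measure[of M "\<lambda>\<omega>. ?Z \<omega> ^ 4" "space M" "\<delta> ^ 4"]
    by (simp add: has_bochner_integral_iff)
  then show ?thesis
    using has_bochner_integral_integral_eq[OF Z4] \<delta> I by (simp add: I4 field_simps)
qed

end

section \<open>Strong consistency and the asymptotics of the Bayes estimate\<close>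

lemma mle_error_tendsto_0:
  fixes M :: "'a measure" and \<mu> q :: "nat \<Rightarrow> real" and \<sigma> T :: real
  assumes \<sigma>: "\<sigma> > 0" and T: "T > 0" and \<mu>_pos: "\<And>k. k \<ge> 1 \<Longrightarrow> \<mu> k > 0"
    and q_pos: "\<And>k. k \<ge> 1 \<Longrightarrow> q k > 0"
    and basis: "stochastic_basis M F" and brownian: "independent_brownian_motions M F w {1..}"
    and growth: "\<forall>\<^sub>F N in sequentially. real N \<le> fisher_info \<mu> q \<sigma> T N"
  shows "AE \<omega> in M. (\<lambda>N. mle_error \<mu> q \<sigma> T w N \<omega>) \<longlonglongrightarrow> 0"
proof -
  interpret stochastic_basis M F by fact
  let ?Z = "mle_error \<mu> q \<sigma> T w"
  have Z_meas: "?Z N \<in> borel_measurable M" for N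
  proof (cases "N \<ge> 1")
    case True
    then show ?thesis
      using mle_error_distribution[OF \<sigma> T \<mu>_pos q_pos True basis brownian]
      by (simp add: distributed_def)
  next
    case False
    then have "?Z N = (\<lambda>_. 0)" by (auto simp: mle_error_def)
    then show ?thesis by simp
  qed
  have small: "AE \<omega> in M. \<forall>\<^sub>F N in sequentially. \<bar>?Z N \<omega>\<bar> < \<delta>" if \<delta>: "0 < \<delta>" for \<delta>
  proof -
    let ?A = "\<lambda>N. {\<omega> \<in> space M. \<delta> \<le> \<bar>?Z N \<omega>\<bar>}"
    have "summable (\<lambda>N. 3 / \<delta> ^ 4 * inverse (real N ^ 2))"
      by (intro summable_mult inverse_power_summable) simp
    moreover have "\<forall>\<^sub>F N in sequentially. norm (measure M (?A N)) \<le> 3 / \<delta> ^ 4 * inverse (real N ^ 2)"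
      using growth eventually_ge_at_top[of 1]
    proof eventually_elim
      case (elim N)
      have "measure M (?A N) \<le> 3 / (\<delta> ^ 4 * (fisher_info \<mu> q \<sigma> T N)\<^sup>2)"
        by (rule mle_error_tail[OF \<sigma> T \<mu>_pos q_pos elim(2) basis brownian \<delta>])
      also have "\<dots> \<le> 3 / (\<delta> ^ 4 * (real N)\<^sup>2)"
        using elim \<delta> by (intro divide_left_mono mult_left_mono power_mono mult_pos_pos zero_less_power) auto
      finally show ?case by (simp add: field_simps)
    qed
    ultimately have "summable (\<lambda>N. measure M (?A N))"
      by (rule summable_comparison_test_ev[rotated])
    moreover have "?A N \<in> sets M" for N using Z_meas[of N] by measurable
    ultimately have "AE \<omega> in M. \<forall>\<^sub>F N in sequentially. \<omega> \<in> space M - ?A N"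
      by (intro borel_cantelli_AE1) (auto simp: emeasure_eq_measure)
    then show ?thesis
      by eventually_elim (auto elim!: eventually_mono simp: not_le)
  qed
  have "AE \<omega> in M. \<forall>m. \<forall>\<^sub>F N in sequentially. \<bar>?Z N \<omega>\<bar> < 1 / real (Suc m)"
    unfolding AE_all_countable by (intro allI small) simp
  then show ?thesis
  proof eventually_elim
    case (elim \<omega>)
    show ?case
    proof (rule tendstoI)
      fix e :: real assume "0 < e"
      then obtain m where m: "inverse (real (Suc m)) < e" using reals_Archimedean by blast
      show "\<forall>\<^sub>F N in sequentially. dist (?Z N \<omega>) 0 < e"
        using elim[rule_format, of m] m by (auto elim!: eventually_mono simp: inverse_eq_divide)
    qed
  qed
qed

theorem theorem4p10:
  fixes M :: "'a measure" and F :: "real \<Rightarrow> 'a measure"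
    and w :: "nat \<Rightarrow> real \<Rightarrow> 'a \<Rightarrow> real" and u0 :: "nat \<Rightarrow> 'a \<Rightarrow> real"
    and u :: "real \<Rightarrow> nat \<Rightarrow> real \<Rightarrow> 'a \<Rightarrow> real" and J :: "real \<Rightarrow> nat \<Rightarrow> 'a \<Rightarrow> real"
    and \<mu> q :: "nat \<Rightarrow> real" and \<sigma> T :: real
    and \<rho> l :: "real \<Rightarrow> real"
    and I :: "nat \<Rightarrow> real" and \<theta>h \<beta>t :: "real \<Rightarrow> nat \<Rightarrow> 'a \<Rightarrow> real"
  assumes basis: "stochastic_basis M F"
    and brownian: "independent_brownian_motions M F w {1..}"
    and \<sigma>_pos: "\<sigma> > 0" and T_pos: "T > 0"
    and \<mu>_pos: "\<And>k. k \<ge> 1 \<Longrightarrow> \<mu> k > 0" and \<mu>_lim: "filterlim \<mu> at_top sequentially"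
    and q_pos: "\<And>k. k \<ge> 1 \<Longrightarrow> q k > 0"
    and well_posed: "\<exists>\<theta>bar N0 c. \<theta>bar > 0 \<and> N0 \<ge> 1 \<and> c > 0 \<and>
        (\<forall>k\<ge>N0. 2 * \<theta>bar - \<sigma>\<^sup>2 * (q k)\<^sup>2 / \<mu> k \<ge> c)"
    and u0_meas: "\<And>k. k \<ge> 1 \<Longrightarrow> u0 k \<in> borel_measurable (F 0)"
    and u0_nz: "\<And>k. k \<ge> 1 \<Longrightarrow> AE \<omega> in M. u0 k \<omega> \<noteq> 0"
    and u_def: "u \<equiv> fourier_mode \<mu> q \<sigma> w u0"
    and J_integral: "\<And>\<theta>0 k. \<theta>0 > 0 \<Longrightarrow> k \<ge> 1 \<Longrightarrow>
        is_stochastic_integral M T (\<lambda>t \<omega>. 1 / u \<theta>0 k t \<omega>) (u \<theta>0 k) (J \<theta>0 k)"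
    and I_def: "I \<equiv> fisher_info \<mu> q \<sigma> T"
    and \<theta>h_def: "\<theta>h \<equiv> \<lambda>\<theta>0. theta_hat \<mu> q T (J \<theta>0)"
    and \<beta>t_def: "\<beta>t \<equiv> \<lambda>\<theta>0 N \<omega>. bayes_estimate l \<rho> (I N) (\<theta>h \<theta>0 N \<omega>)"
    and prior: "\<rho> \<in> prior_class_e2"
    and loss: "l \<in> loss_class_e2"
    and strict_min: "strict_min_on
        (\<lambda>r. \<integral>\<^sup>+x. ennreal (l (x + r) * exp (- (x\<^sup>2 / 2))) \<partial>lborel) UNIV 0"
    and posterior: "\<And>\<theta>0 N. \<theta>0 > 0 \<Longrightarrow> N \<ge> 1 \<Longrightarrow>
        AE \<omega> in M. posterior_exists \<rho> (I N) (\<theta>h \<theta>0 N \<omega>)"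
    and well_defined: "\<And>\<theta>0 N. \<theta>0 > 0 \<Longrightarrow> N \<ge> 1 \<Longrightarrow>
        AE \<omega> in M. bayes_well_defined l \<rho> (I N) (\<theta>h \<theta>0 N \<omega>)"
  shows "(\<forall>\<theta>0>0. AE \<omega> in M.
            (\<lambda>N. sqrt (I N) * (\<beta>t \<theta>0 N \<omega> - \<theta>h \<theta>0 N \<omega>)) \<longlonglongrightarrow> 0) \<and>
         (\<forall>B \<epsilon>. compact B \<and> B \<subseteq> {0<..} \<and> \<epsilon> > 0 \<longrightarrow>
            (\<lambda>N. \<Squnion>\<theta>0\<in>B. emeasure M
               {\<omega> \<in> space M. sqrt (I N) * \<bar>\<beta>t \<theta>0 N \<omega> - \<theta>h \<theta>0 N \<omega>\<bar> > \<epsilon>}) \<longlonglongrightarrow> 0)"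
proof -
  interpret stochastic_basis M F by (rule basis)
  let ?Z = "mle_error \<mu> q \<sigma> T w"
  have growth: "\<forall>\<^sub>F N in sequentially. real N \<le> I N"
    unfolding I_def by (rule fisher_info_grows_linearly[OF \<sigma>_pos T_pos \<mu>_lim q_pos well_posed])
  have I_lim: "filterlim I at_top sequentially"
    using filterlim_real_sequentially growth by (rule filterlim_at_top_mono)
  have Z_lim: "AE \<omega> in M. (\<lambda>N. ?Z N \<omega>) \<longlonglongrightarrow> 0"
    by (rule mle_error_tendsto_0[OF \<sigma>_pos T_pos \<mu>_pos q_pos basis brownian])
       (use growth in \<open>simp_all add: I_def\<close>)
  have J_eq: "AE \<omega> in M. J \<theta>0 k \<omega> = \<sigma> * q k * (w k T \<omega> - w k 0 \<omega>) - \<theta>0 * \<mu> k * T"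
    if "\<theta>0 > 0" "k \<ge> 1" for \<theta>0 k
  proof (rule log_integral_geometric_brownian_motion[OF basis _ T_pos _ u0_nz[OF that(2)] _ J_integral[OF that]])
    show "brownian_motion M F (w k)" using brownian that by (simp add: independent_brownian_motions_def)
    show "u0 k \<in> borel_measurable M"
      using measurable_from_subalg[OF subalgebra u0_meas] that by simp
    show "u \<theta>0 k = (\<lambda>t \<omega>. u0 k \<omega> * exp (- (\<theta>0 * \<mu> k + (\<sigma> * q k)\<^sup>2 / 2) * t + \<sigma> * q k * w k t \<omega>))"
      by (simp add: u_def fourier_mode_def fun_eq_iff power_mult_distrib)
  qed
  have good: "AE \<omega> in M. \<forall>N\<ge>1. \<theta>h \<theta>0 N \<omega> = \<theta>0 + ?Z N \<omega> \<and>
      posterior_exists \<rho> (I N) (\<theta>h \<theta>0 N \<omega>) \<and> bayes_well_defined l \<rho> (I N) (\<theta>h \<theta>0 N \<omega>)"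
    if \<theta>0: "\<theta>0 > 0" for \<theta>0
  proof -
    have "AE \<omega> in M. \<forall>k. k \<ge> 1 \<longrightarrow> J \<theta>0 k \<omega> = \<sigma> * q k * (w k T \<omega> - w k 0 \<omega>) - \<theta>0 * \<mu> k * T"
      unfolding AE_all_countable using J_eq[OF \<theta>0] by auto
    moreover have "AE \<omega> in M. \<forall>N. N \<ge> 1 \<longrightarrow> posterior_exists \<rho> (I N) (\<theta>h \<theta>0 N \<omega>)"
      unfolding AE_all_countable using posterior[OF \<theta>0] by auto
    moreover have "AE \<omega> in M. \<forall>N. N \<ge> 1 \<longrightarrow> bayes_well_defined l \<rho> (I N) (\<theta>h \<theta>0 N \<omega>)"
      unfolding AE_all_countable using well_defined[OF \<theta>0] by auto
    ultimately show ?thesis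
      by eventually_elim
         (auto simp: \<theta>h_def intro!: theta_hat_eq_mle_error[OF \<sigma>_pos T_pos \<mu>_pos q_pos])
  qed
  show ?thesis
  proof (intro conjI allI impI)
    fix \<theta>0 :: real assume \<theta>0: "0 < \<theta>0"
    define K where "K = {\<theta>0 / 2..2 * \<theta>0}"
    have K: "compact K" "K \<subseteq> {0<..}" using \<theta>0 by (auto simp: K_def)
    show "AE \<omega> in M. (\<lambda>N. sqrt (I N) * (\<beta>t \<theta>0 N \<omega> - \<theta>h \<theta>0 N \<omega>)) \<longlonglongrightarrow> 0"
      using good[OF \<theta>0] Z_lim
    proof eventually_elim
      case (elim \<omega>)
      note good_\<omega> = elim(1)
      have h_lim: "(\<lambda>N. \<theta>0 + ?Z N \<omega>) \<longlonglongrightarrow> \<theta>0 + 0" by (intro tendsto_add tendsto_const elim)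
      then have "\<forall>\<^sub>F N in sequentially. \<theta>0 / 2 < \<theta>0 + ?Z N \<omega>" "\<forall>\<^sub>F N in sequentially. \<theta>0 + ?Z N \<omega> < 2 * \<theta>0"
        using \<theta>0 by (intro order_tendstoD[OF h_lim]; simp)+
      with eventually_ge_at_top[of 1] have in_K: "\<forall>\<^sub>F N in sequentially. N \<ge> 1 \<and> \<theta>h \<theta>0 N \<omega> \<in> K"
        by eventually_elim (use good_\<omega> in \<open>auto simp: K_def\<close>)
      show ?case
      proof (rule tendstoI)
        fix e :: real assume e: "0 < e"
        then have "0 < e / 2" by simp
        from bayes_estimate_near_mle[OF prior loss strict_min K this] obtain I0 where I0:
          "\<And>I h. I0 \<le> I \<Longrightarrow> h \<in> K \<Longrightarrow> posterior_exists \<rho> I h \<Longrightarrow> bayes_well_defined l \<rho> I h \<Longrightarrow>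
            sqrt I * \<bar>bayes_estimate l \<rho> I h - h\<bar> \<le> e / 2" by blast
        have "\<forall>\<^sub>F N in sequentially. max I0 0 \<le> I N" using I_lim unfolding filterlim_at_top by blast
        with in_K show "\<forall>\<^sub>F N in sequentially. dist (sqrt (I N) * (\<beta>t \<theta>0 N \<omega> - \<theta>h \<theta>0 N \<omega>)) 0 < e"
        proof eventually_elim
          case (elim N)
          have "sqrt (I N) * \<bar>\<beta>t \<theta>0 N \<omega> - \<theta>h \<theta>0 N \<omega>\<bar> \<le> e / 2"
            unfolding \<beta>t_def using elim good_\<omega> by (intro I0) auto
          then show ?case using e elim by (simp add: abs_mult)
        qed
      qed
    qed
  next
    fix B :: "real set" and \<epsilon> :: real
    assume "compact B \<and> B \<subseteq> {0<..} \<and> \<epsilon> > 0"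
    then have B: "compact B" "B \<subseteq> {0<..}" and \<epsilon>: "0 < \<epsilon>" by auto
    obtain a b where ab: "0 < a" "B \<subseteq> {a..b}"
    proof (cases "B = {}")
      case True
      then show thesis using that[of 1 1] by simp
    next
      case False
      then obtain x y where "x \<in> B" "\<forall>t\<in>B. x \<le> t" "\<forall>t\<in>B. t \<le> y"
        using compact_attains_inf[OF B(1)] compact_attains_sup[OF B(1)] by blast
      then have "0 < x" "B \<subseteq> {x..y}" using B(2) by auto
      then show thesis by (rule that)
    qed
    \<comment> \<open>A compact neighbourhood of \<open>B\<close>: the estimate leaves it only if its error is at least \<open>a / 2\<close>.\<close>
    define K where "K = {a / 2..b + a / 2}"
    have K: "compact K" "K \<subseteq> {0<..}" using ab by (auto simp: K_def)
    from bayes_estimate_near_mle[OF prior loss strict_min K \<epsilon>] obtain I0 where I0: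
      "\<And>I h. I0 \<le> I \<Longrightarrow> h \<in> K \<Longrightarrow> posterior_exists \<rho> I h \<Longrightarrow> bayes_well_defined l \<rho> I h \<Longrightarrow>
        sqrt I * \<bar>bayes_estimate l \<rho> I h - h\<bar> \<le> \<epsilon>" by blast
    let ?P = "\<lambda>\<theta>0 N. emeasure M {\<omega> \<in> space M. sqrt (I N) * \<bar>\<beta>t \<theta>0 N \<omega> - \<theta>h \<theta>0 N \<omega>\<bar> > \<epsilon>}"
    have "\<forall>\<^sub>F N in sequentially. max I0 1 \<le> I N" using I_lim unfolding filterlim_at_top by blast
    with eventually_ge_at_top[of 1]
    have bound: "\<forall>\<^sub>F N in sequentially. (\<Squnion>\<theta>0\<in>B. ?P \<theta>0 N) \<le> ennreal (3 / ((a / 2) ^ 4 * (I N)\<^sup>2))"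
    proof eventually_elim
      case (elim N)
      let ?A = "{\<omega> \<in> space M. a / 2 \<le> \<bar>?Z N \<omega>\<bar>}"
      have "?Z N \<in> borel_measurable M"
        using mle_error_distribution[OF \<sigma>_pos T_pos \<mu>_pos q_pos elim(1) basis brownian]
        by (simp add: distributed_def)
      then have A: "?A \<in> sets M" by measurable
      have "?P \<theta>0 N \<le> emeasure M ?A" if "\<theta>0 \<in> B" for \<theta>0
      proof (rule emeasure_mono_AE[OF _ A])
        have \<theta>0: "a \<le> \<theta>0" "\<theta>0 \<le> b" "0 < \<theta>0" using that ab by auto
        from good[OF \<theta>0(3)]
        show "AE \<omega> in M. \<omega> \<in> {\<omega> \<in> space M. sqrt (I N) * \<bar>\<beta>t \<theta>0 N \<omega> - \<theta>h \<theta>0 N \<omega>\<bar> > \<epsilon>} \<longrightarrow> \<omega> \<in> ?A"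
        proof eventually_elim
          case (elim \<omega>)
          note g = elim[rule_format, OF \<open>1 \<le> N\<close>]
          have "sqrt (I N) * \<bar>\<beta>t \<theta>0 N \<omega> - \<theta>h \<theta>0 N \<omega>\<bar> \<le> \<epsilon>" if "\<bar>?Z N \<omega>\<bar> < a / 2"
          proof -
            have "\<theta>h \<theta>0 N \<omega> \<in> K" using g that \<theta>0 by (auto simp: K_def)
            then show ?thesis unfolding \<beta>t_def using g \<open>max I0 1 \<le> I N\<close> by (intro I0) auto
          qed
          then show ?case by (auto simp: not_le[symmetric])
        qed
      qed
      then have "(\<Squnion>\<theta>0\<in>B. ?P \<theta>0 N) \<le> emeasure M ?A" by (rule SUP_least)
      also have "\<dots> \<le> ennreal (3 / ((a / 2) ^ 4 * (I N)\<^sup>2))"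
        using mle_error_tail[OF \<sigma>_pos T_pos \<mu>_pos q_pos elim(1) basis brownian, where \<delta> = "a / 2"] ab(1)
        by (simp add: emeasure_eq_measure I_def ennreal_leI)
      finally show ?case .
    qed
    have "((\<lambda>t. 3 / ((a / 2) ^ 4 * t\<^sup>2)) \<longlongrightarrow> 0) at_top" using ab(1) by real_asymp
    from tendsto_ennrealI[OF filterlim_compose[OF this I_lim]]
    have "(\<lambda>N. ennreal (3 / ((a / 2) ^ 4 * (I N)\<^sup>2))) \<longlonglongrightarrow> 0" by simp
    with bound show "(\<lambda>N. \<Squnion>\<theta>0\<in>B. ?P \<theta>0 N) \<longlonglongrightarrow> 0"
      by (rule tendsto_sandwich[OF always_eventually[OF allI[OF zero_le]] _ tendsto_const])
  qed
qed

end
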